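(* Let $\alpha=\beta>-\frac12$ and $\gamma=\alpha+\frac12$. Let $p_t(x,y)$ be the ultraspherical Jacobi semi-group density $$p_t(x,y)=\Big(\sum_{n\ge0}R_n^{-1}e^{-n(n+2\alpha+1)t}P_n^{\alpha,\alpha}(x)P_n^{\alpha,\alpha}(y)\Big)W(y).$$ Then for all $t>0$ and $x,y\in(-1,1)$, $$p_t(x,y)=\sqrt{\pi}\,K_\alpha\,\frac{e^{\gamma^2t}}{\sqrt t}\,W(y)\sum_{n,k\ge0}\frac{\Gamma(\nu(n,k,\alpha)+1)\,(xy)^k}{k!\,n!\,\Gamma(\alpha+n+1)}\left[\frac{(1-x^2)(1-y^2)}{4}\right]^n\big(f_{T_1}\star f_{C_{\nu(n,k,\alpha)}}\big)\!\left(\frac1{2t}\right),$$ where $\nu(n,k,\alpha)=2n+k+\alpha+\frac12$ and $K_\alpha=\dfrac{\Gamma(\alpha+1)}{2^{\alpha+1/2}\,\Gamma(\alpha+3/2)}$.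
   Context: Jacobi polynomials: $P_n^{\alpha,\beta}(x)=\frac{(\alpha+1)_n}{n!}\,{}_2F_1\big(-n,n+\alpha+\beta+1;\alpha+1;\frac{1-x}{2}\big)$, where $(c)_n=\Gamma(c+n)/\Gamma(c)$ is the Pochhammer symbol. Weight (a probability density on $[-1,1]$) for $\alpha=\beta$: $W(y)=\dfrac{(1-y^2)^\alpha}{2^{2\alpha+1}B(\alpha+1,\alpha+1)}$, with $B$ the Beta function. Squared norms: $$R_n=\int_{-1}^1 P_n^{\alpha,\alpha}(y)^2\,W(y)\,dy=\frac{\Gamma(2\alpha+2)}{2n+2\alpha+1}\,\frac{\big((\alpha+1)_n\big)^2}{\Gamma(2\alpha+n+1)\,n!}.$$ The function $p_t(x,y)$ is the transition density of the Jacobi process on $[-1,1]$ with generator $(1-x^2)\frac{d^2}{dx^2}-2(\alpha+1)x\frac{d}{dx}$. The functions $f_{C_h}$ ($h>0$) and $f_{T_1}$ are probability densities on $(0,\infty)$ given for $s>0$ by $$f_{C_h}(s)=\frac{2^h}{\Gamma(h)}\sum_{p\ge0}(-1)^p\frac{\Gamma(p+h)}{p!}\,\frac{2p+h}{\sqrt{2\pi s^3}}\exp\Big(-\frac{(2p+h)^2}{2s}\Big),\qquad f_{T_1}(s)=\sum_{k\ge0}e^{-\frac{\pi^2}{2}(k+\frac12)^2s}.$$ Their Laplace transforms are $\int_0^\infty e^{-\frac{t^2}{2}s}f_{C_h}(s)\,ds=(\cosh t)^{-h}$ and $\int_0^\infty e^{-\frac{t^2}{2}s}f_{T_1}(s)\,ds=\frac{\tanh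 t}{t}$. The symbol $\star$ denotes convolution on $(0,\infty)$: $(f\star g)(s)=\int_0^s f(s-r)g(r)\,dr$. *)

theory Defs
  imports "HOL-Analysis.Analysis"
begin

(* The series terminates when a or b is a nonpositive integer, which is the only case used. *)
definition hyp2F1 :: "real \<Rightarrow> real \<Rightarrow> real \<Rightarrow> real \<Rightarrow> real" where
  "hyp2F1 a b c z = eval_fps (fps_hypergeo [a, b] [c] 1) z"

definition jacobi_P :: "nat \<Rightarrow> real \<Rightarrow> real \<Rightarrow> real \<Rightarrow> real" where
  "jacobi_P n \<alpha> \<beta> x =
     pochhammer (\<alpha> + 1) n / fact n
       * hyp2F1 (- real n) (real n + \<alpha> + \<beta> + 1) (\<alpha> + 1) ((1 - x) / 2)"

(* Only meaningful on [-1,1]. *)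
definition ultra_weight :: "real \<Rightarrow> real \<Rightarrow> real" where
  "ultra_weight \<alpha> y =
     (1 - y\<^sup>2) powr \<alpha> / (2 powr (2 * \<alpha> + 1) * Beta (\<alpha> + 1) (\<alpha> + 1))"

definition ultra_sqnorm :: "nat \<Rightarrow> real \<Rightarrow> real" where
  "ultra_sqnorm n \<alpha> = (LBINT y:{-1..1}. (jacobi_P n \<alpha> \<alpha> y)\<^sup>2 * ultra_weight \<alpha> y)"

definition ultra_density :: "real \<Rightarrow> real \<Rightarrow> real \<Rightarrow> real \<Rightarrow> real" where
  "ultra_density \<alpha> t x y =
     (\<Sum>n. inverse (ultra_sqnorm n \<alpha>) * exp (- (real n * (real n + 2 * \<alpha> + 1) * t))
            * jacobi_P n \<alpha> \<alpha> x * jacobi_P n \<alpha> \<alpha> y)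
     * ultra_weight \<alpha> y"

definition f_C :: "real \<Rightarrow> real \<Rightarrow> real" where
  "f_C h s =
     2 powr h / Gamma h
     * (\<Sum>p. (-1) ^ p * (Gamma (real p + h) / fact p)
              * ((2 * real p + h) / sqrt (2 * pi * s ^ 3))
              * exp (- ((2 * real p + h)\<^sup>2 / (2 * s))))"

definition f_T1 :: "real \<Rightarrow> real" where
  "f_T1 s = (\<Sum>k. exp (- (pi\<^sup>2 / 2 * (real k + 1/2)\<^sup>2 * s)))"

definition convolution :: "(real \<Rightarrow> real) \<Rightarrow> (real \<Rightarrow> real) \<Rightarrow> real \<Rightarrow> real"
    (infixl "\<star>" 70) where
  "(f \<star> g) s = (LBINT r:{0<..<s}. f (s - r) * g r)"

definition nu :: "nat \<Rightarrow> nat \<Rightarrow> real \<Rightarrow> real" where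
  "nu n k \<alpha> = 2 * real n + real k + \<alpha> + 1/2"

definition K_const :: "real \<Rightarrow> real" where
  "K_const \<alpha> = Gamma (\<alpha> + 1) / (2 powr (\<alpha> + 1/2) * Gamma (\<alpha> + 3/2))"

end

(*
  Write e^{-n(n+2c)t} = e^{c^2 t} e^{-(n+c)^2 t} with c = alpha + 1/2. Two facts make the two
  expansions agree term by term.

  Algebra: P_N(x) P_N(y) is, up to a constant, the sum over n of w^n / (n! Gamma(alpha+1+n)) times
  Gamma(c+2n) C_{N-2n}^{c+2n}(xy), where w = (1-x^2)(1-y^2) and C is a Gegenbauer polynomial. Indeed
  the sum satisfies the ultraspherical equation in x (the terms telescope), polynomial solutions of
  that equation are unique up to a factor, and at x = 1 only the term n = 0 survives.

  Analysis: by Jacobi's theta identity and the semigroup property of hitting times,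
  f_{T_1} * f_{C_nu}(s) is the sum over m of the coefficients of tanh u / cosh^nu u in powers of
  e^{-u}, each weighted by the Gaussian (2 pi s)^{-1/2} e^{-(2m+nu)^2/(2s)}. No Laplace inversion is
  needed. With s = 1/(2t), collecting the triple sum over (n,k,m) along N = 2n+k+2m gives back the
  spectral expansion.
*)

theory Submission
  imports Defs "HOL-Probability.Characteristic_Functions" "HOL-Computational_Algebra.Polynomial"
begin

section \<open>Gegenbauer polynomials and the ultraspherical equation\<close>

text \<open>With transform kernel e^(-t^2 s/2) in s, \<open>heat a\<close> (a >= 0) has transform
  e^(-a t)/t and \<open>hitting b\<close> has e^(-b t), so their convolution must be
  \<open>heat (a + b)\<close>; an explicit antiderivative confirms this. The hurdle is that
  \<open>f_T1\<close> is given as a spectral sum of exponentials in s while \<open>f_C\<close> is a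
  sum of hitting densities; the theta identity brings both to the same kind of expansion. The
  coefficients of tanh / cosh^nu are explicit because tanh * cosh^(-nu) is -1/nu times the
  derivative of cosh^(-nu), which multiplies the m-th coefficient of cosh^(-nu) by (nu + 2m)/nu.
  This factor does two jobs: nu + 2m equals N + c, the dependence on N left over from the norms, and
  Gamma(nu + 1)/nu turns (nu)_m into Gamma(nu + m), the numerator in the Gegenbauer polynomial.
  Regrouping is legitimate because at fixed N the Gaussian e^(-(N + c)^2 t) outweighs factorial
  growth, which makes the triple family absolutely summable. The condition alpha > -1/2 enters as c
  > 0.\<close>

lemma Gamma_real_plus1: "(x::real) > 0 \<Longrightarrow> Gamma (x + 1) = x * Gamma x"
  by (rule Gamma_plus1) (auto simp: nonpos_Ints_def)

text \<open>The \<open>i\<close>-th derivative of \<open>Gamma l * C\<close>, \<open>C\<close> the Gegenbauer polynomial of degree \<open>M\<close> and parameter \<open>l\<close>.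
  The guard discards the terms killed by differentiation, where natural subtraction would truncate.\<close>

definition gegenbauer_deriv :: "nat \<Rightarrow> nat \<Rightarrow> real \<Rightarrow> real \<Rightarrow> real" where
  "gegenbauer_deriv i M l z = (\<Sum>m\<le>M. if i + 2 * m \<le> M then
     (-1) ^ m * Gamma (l + real M - real m) / (fact m * fact (M - 2 * m - i))
       * 2 ^ (M - 2 * m) * z ^ (M - 2 * m - i) else 0)"

lemma gegenbauer_deriv_has_derivative:
  "(gegenbauer_deriv i M l has_real_derivative gegenbauer_deriv (Suc i) M l z) (at z)"
  unfolding gegenbauer_deriv_def
proof (rule DERIV_sum)
  fix m
  show "((\<lambda>z. if i + 2 * m \<le> M then
     (-1) ^ m * Gamma (l + real M - real m) / (fact m * fact (M - 2 * m - i))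
       * 2 ^ (M - 2 * m) * z ^ (M - 2 * m - i) else 0) has_real_derivative
     (if Suc i + 2 * m \<le> M then
     (-1) ^ m * Gamma (l + real M - real m) / (fact m * fact (M - 2 * m - Suc i))
       * 2 ^ (M - 2 * m) * z ^ (M - 2 * m - Suc i) else 0)) (at z)"
  proof (cases "Suc i + 2 * m \<le> M")
    case True
    define j where "j = M - 2 * m - Suc i"
    have j: "M - 2 * m - i = Suc j" "M - 2 * m - Suc i = j" using True by (auto simp: j_def)
    have "((\<lambda>z. z ^ Suc j) has_real_derivative real (Suc j) * z ^ j) (at z)"
      using DERIV_pow[of "Suc j" z] by (simp del: of_nat_Suc power_Suc)
    from DERIV_cmult[OF this, of "(-1) ^ m * Gamma (l + real M - real m)
        / (fact m * fact (Suc j)) * 2 ^ (M - 2 * m)"]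
    show ?thesis using True unfolding j by (simp add: fact_Suc mult.assoc del: of_nat_Suc)
  next
    case False
    \<comment> \<open>Either the guard already fails or the power is z^0; truncated subtraction
      gives exponent 0 in both situations, so the summand is constant in z.\<close>
    have *: "M - 2 * m - i = 0" using False by auto
    have nle: "(Suc i + 2 * m \<le> M) = False" using False by blast
    show ?thesis unfolding * nle power_0 if_False by (rule DERIV_const)
  qed
qed

text \<open>On z^(M - 2m) the part M(M + 2l) - (2l + 1) z D - z^2 D^2 acts by a scalar, while D^2
  moves the term to the next lower power. The coefficients are such that the two contributions
  telescope in m.\<close>

lemma gegenbauer_deriv_ode:
  assumes l: "l > 0"
  shows "(1 - z\<^sup>2) * gegenbauer_deriv 2 M l z - (2 * l + 1) * z * gegenbauer_deriv 1 M l z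
     + real M * (real M + 2 * l) * gegenbauer_deriv 0 M l z = 0"
proof -
  define T where "T m = (if 2 * m \<le> M then
     (-1) ^ m * Gamma (l + real M - real m) / (fact m * fact (M - 2 * m))
       * 2 ^ (M - 2 * m) * z ^ (M - 2 * m) else 0)" for m
  define j where "j m = real M - 2 * real m" for m
  \<comment> \<open>4m(l + M - m) is the scalar M(M + 2l) - (2l + 1)j - j(j - 1) at j = M -
    2m.\<close>
  define U where "U m = 4 * real m * (l + real M - real m) * T m" for m
  have D0: "gegenbauer_deriv 0 M l z = (\<Sum>m\<le>M. T m)"
    unfolding gegenbauer_deriv_def T_def by (intro sum.cong) auto
  have D1: "z * gegenbauer_deriv 1 M l z = (\<Sum>m\<le>M. j m * T m)"
    unfolding gegenbauer_deriv_def sum_distrib_left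
  proof (rule sum.cong[OF refl])
    fix m
    show "z * (if 1 + 2 * m \<le> M then
     (-1) ^ m * Gamma (l + real M - real m) / (fact m * fact (M - 2 * m - 1))
       * 2 ^ (M - 2 * m) * z ^ (M - 2 * m - 1) else 0) = j m * T m"
    proof (cases "1 + 2 * m \<le> M")
      case True
      then obtain i where i: "M = 1 + 2 * m + i" by (auto simp: le_iff_add)
      show ?thesis by (simp add: i T_def j_def)
    next
      case False
      then have "2 * m \<le> M \<Longrightarrow> j m = 0" by (simp add: j_def)
      then show ?thesis using False by (auto simp: T_def)
    qed
  qed
  have D2: "z\<^sup>2 * gegenbauer_deriv 2 M l z = (\<Sum>m\<le>M. j m * (j m - 1) * T m)"
    unfolding gegenbauer_deriv_def sum_distrib_left
  proof (rule sum.cong[OF refl])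
    fix m
    show "z\<^sup>2 * (if 2 + 2 * m \<le> M then
     (-1) ^ m * Gamma (l + real M - real m) / (fact m * fact (M - 2 * m - 2))
       * 2 ^ (M - 2 * m) * z ^ (M - 2 * m - 2) else 0) = j m * (j m - 1) * T m"
    proof (cases "2 + 2 * m \<le> M")
      case True
      then obtain i where i: "M = 2 + 2 * m + i" by (auto simp: le_iff_add)
      define p q where "p = real i + 2" and "q = real i + 1"
      have "p \<noteq> 0" "q \<noteq> 0" "fact (M - 2 * m) = p * q * (fact i :: real)" "j m = p"
        "p - 1 = q" "M - 2 * m = Suc (Suc i)" "M - 2 * m - 2 = i"
        by (simp_all add: i p_def q_def j_def algebra_simps)
      then show ?thesis using True
        by (simp add: T_def power2_eq_square del: fact_Suc of_nat_Suc)
    next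
      case False
      then have "2 * m \<le> M \<Longrightarrow> M = 2 * m \<or> M = 2 * m + 1" by arith
      then have "2 * m \<le> M \<Longrightarrow> j m * (j m - 1) = 0" by (auto simp add: j_def)
      then show ?thesis using False by (auto simp: T_def)
    qed
  qed
  \<comment> \<open>A second reading of the second derivative: one step of the Gamma recurrence and
    the two spare powers of 2 turn the m-th summand into minus the scalar part of index m +
    1.\<close>
  have D2': "gegenbauer_deriv 2 M l z = (\<Sum>m\<le>M. - U (Suc m))"
    unfolding gegenbauer_deriv_def
  proof (rule sum.cong[OF refl])
    fix m
    show "(if 2 + 2 * m \<le> M then
     (-1) ^ m * Gamma (l + real M - real m) / (fact m * fact (M - 2 * m - 2))
       * 2 ^ (M - 2 * m) * z ^ (M - 2 * m - 2) else 0) = - U (Suc m)"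
    proof (cases "2 + 2 * m \<le> M")
      case True
      then obtain i where i: "M = 2 + 2 * m + i" by (auto simp: le_iff_add)
      define q where "q = l + 1 + real m + real i"
      have "l + real M - real m = q + 1"
        by (simp add: i q_def)
      then have "Gamma (l + real M - real m) = q * Gamma q"
        using l by (simp only:, intro Gamma_real_plus1) (auto simp: q_def)
      moreover have "l + real M - real (Suc m) = q"
        "M - 2 * Suc m = i"
        "M - 2 * m = Suc (Suc i)" "M - 2 * m - 2 = i"
        by (simp_all add: i q_def)
      ultimately show ?thesis using True
        by (simp add: T_def U_def del: of_nat_Suc)
    next
      case False
      then show ?thesis by (auto simp: T_def U_def)
    qed
  qed
  have "(\<Sum>m\<le>M. U m - U (Suc m)) = U 0 - U (Suc M)"
    by (rule sum_telescope)
  \<comment> \<open>\<open>U 0\<close> vanishes by its factor m, \<open>U (Suc M)\<close> by the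
    guard in \<open>T\<close>.\<close>
  also have "\<dots> = 0" by (simp add: U_def T_def)
  finally have "0 = gegenbauer_deriv 2 M l z + (\<Sum>m\<le>M. U m)"
    by (simp add: D2' sum_subtractf sum_negf)
  also have "(\<Sum>m\<le>M. U m) = (\<Sum>m\<le>M. real M * (real M + 2 * l) * T m
      - (2 * l + 1) * (j m * T m) - j m * (j m - 1) * T m)"
    by (rule sum.cong) (auto simp: U_def j_def algebra_simps)
  also have "\<dots> = real M * (real M + 2 * l) * gegenbauer_deriv 0 M l z - (2 * l + 1) * (z * gegenbauer_deriv 1 M l z)
     - z\<^sup>2 * gegenbauer_deriv 2 M l z"
    unfolding D0 D1 D2 by (simp add: sum_subtractf sum_distrib_left)
  finally show ?thesis by (simp add: algebra_simps)
qed

text \<open>The classical derivative rule has the factor 2l; here l is absorbed in passing from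
  Gamma l to Gamma (l + 1).\<close>

lemma gegenbauer_deriv_1_eq: "gegenbauer_deriv 1 (Suc M) l z = 2 * gegenbauer_deriv 0 M (l + 1) z"
proof -
  have "gegenbauer_deriv 1 (Suc M) l z = (\<Sum>m\<le>M. if 1 + 2 * m \<le> Suc M then
     (-1) ^ m * Gamma (l + real (Suc M) - real m) / (fact m * fact (Suc M - 2 * m - 1))
       * 2 ^ (Suc M - 2 * m) * z ^ (Suc M - 2 * m - 1) else 0)"
    unfolding gegenbauer_deriv_def sum.atMost_Suc by (simp cong: if_cong)
  also have "\<dots> = 2 * gegenbauer_deriv 0 M (l + 1) z"
    unfolding gegenbauer_deriv_def sum_distrib_left
    by (rule sum.cong) (auto simp: Suc_diff_le algebra_simps)
  finally show ?thesis .
qed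

lemma gegenbauer_deriv_2_eq: "gegenbauer_deriv 2 (Suc (Suc M)) l z = 4 * gegenbauer_deriv 0 M (l + 2) z"
proof -
  have "gegenbauer_deriv 2 (Suc (Suc M)) l z = (\<Sum>m\<le>M. if 2 + 2 * m \<le> Suc (Suc M) then
     (-1) ^ m * Gamma (l + real (Suc (Suc M)) - real m)
       / (fact m * fact (Suc (Suc M) - 2 * m - 2))
       * 2 ^ (Suc (Suc M) - 2 * m) * z ^ (Suc (Suc M) - 2 * m - 2) else 0)"
    unfolding gegenbauer_deriv_def sum.atMost_Suc by (simp cong: if_cong)
  also have "\<dots> = 4 * gegenbauer_deriv 0 M (l + 2) z"
    unfolding gegenbauer_deriv_def sum_distrib_left
    by (rule sum.cong) (auto simp: Suc_diff_le algebra_simps)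
  finally show ?thesis .
qed

lemma gegenbauer_deriv_2_small: "M < 2 \<Longrightarrow> gegenbauer_deriv 2 M l z = 0"
  by (auto simp: gegenbauer_deriv_def)

text \<open>At z = 1 the equation loses its second-order term and expresses the value through the
  first derivative, which has degree one less and parameter l + 1; hence the induction for all l at
  once.\<close>

lemma gegenbauer_deriv_at_1:
  assumes "l > 0"
  shows "gegenbauer_deriv 0 M l 1 = Gamma l * pochhammer (2 * l) M / fact M"
  using assms
proof (induction M arbitrary: l)
  case 0
  then show ?case by (simp add: gegenbauer_deriv_def)
next
  case (Suc M)
  have G: "Gamma (l + 1) = l * Gamma l"
    using Suc.prems by (rule Gamma_real_plus1)
  have P: "(2 * l) * (2 * l + 1) * pochhammer (2 * (l + 1)) M
     = pochhammer (2 * l) (Suc M) * (2 * l + real (Suc M))"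
    using pochhammer_rec[of "2 * l" "Suc M"] pochhammer_rec[of "2 * l + 1" M]
      pochhammer_Suc[of "2 * l" "Suc M"] by (simp add: algebra_simps)
  have "real (Suc M) * (real (Suc M) + 2 * l) * gegenbauer_deriv 0 (Suc M) l 1
      = (2 * l + 1) * (2 * gegenbauer_deriv 0 M (l + 1) 1)"
    using gegenbauer_deriv_ode[OF Suc.prems, of 1 "Suc M"] unfolding gegenbauer_deriv_1_eq by simp
  also have "\<dots> = Gamma l * ((2 * l) * (2 * l + 1) * pochhammer (2 * (l + 1)) M) / fact M"
    using Suc.IH[of "l + 1"] Suc.prems by (simp add: G)
  also have "\<dots> = Gamma l * (pochhammer (2 * l) (Suc M) * (2 * l + real (Suc M))) / fact M"
    unfolding P ..
  also have "\<dots> = real (Suc M) * (real (Suc M) + 2 * l)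
      * (Gamma l * pochhammer (2 * l) (Suc M) / fact (Suc M))"
    by (simp add: field_simps del: of_nat_Suc pochhammer_Suc)
  finally show ?case
    using Suc.prems by (subst (asm) mult_cancel_left) auto
qed

section \<open>Polynomial solutions of the hypergeometric and ultraspherical equations\<close>

lemma hyp2F1_terminating:
  "hyp2F1 (- real N) b c z
    = (\<Sum>k\<le>N. pochhammer (- real N) k * pochhammer b k / (pochhammer c k * fact k) * z ^ k)"
proof -
  have "hyp2F1 (- real N) b c z = (\<Sum>k. pochhammer (- real N) k * pochhammer b k
      / (pochhammer c k * fact k) * z ^ k)"
    by (simp add: hyp2F1_def eval_fps_def fps_hypergeo_nth)
  also have "\<dots> = (\<Sum>k\<le>N. pochhammer (- real N) k * pochhammer b k
      / (pochhammer c k * fact k) * z ^ k)"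
    by (rule suminf_finite) (auto simp: pochhammer_of_nat_eq_0_iff)
  finally show ?thesis .
qed

text \<open>Comparing coefficients gives a first-order recursion whose leading factor (j + 1)(j + c)
  is nonzero for c > 0, so the value at 0 determines the polynomial. The factor j - N stops the
  recursion at degree N.\<close>

lemma hypergeometric_ode_unique:
  fixes p :: "real poly"
  assumes c: "c > 0"
    and ode: "\<And>z. z * (1 - z) * poly (pderiv (pderiv p)) z
       + c * (1 - 2 * z) * poly (pderiv p) z
       + real N * (real N + 2 * c - 1) * poly p z = 0"
  shows "poly p z = poly p 0 * hyp2F1 (- real N) (real N + 2 * c - 1) c z"
proof -
  define b where "b = real N + 2 * c - 1"
  have "poly ([:0, 1, -1:] * pderiv (pderiv p) + [:c, - 2 * c:] * pderiv p
      + [:real N * b:] * p) z = poly 0 z" for z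
    using ode[of z] by (simp add: b_def algebra_simps)
  then have eq: "[:0, 1, -1:] * pderiv (pderiv p) + [:c, - 2 * c:] * pderiv p
      + [:real N * b:] * p = 0"
    by (metis poly_eqI poly_eq_poly_eq_iff ext)
  have rec: "(real j + 1) * (real j + c) * coeff p (Suc j)
      = (real j - real N) * (real j + b) * coeff p j" for j
  proof -
    have "coeff ([:0, 1, -1:] * pderiv (pderiv p) + [:c, - 2 * c:] * pderiv p
      + [:real N * b:] * p) j = 0" unfolding eq by simp
    then show ?thesis
      by (cases j) (auto simp: coeff_pderiv coeff_pCons b_def algebra_simps split: nat.splits)
  qed
  have coef: "coeff p k = coeff p 0 *
      (pochhammer (- real N) k * pochhammer b k / (pochhammer c k * fact k))" for k
  proof (induction k)
    case (Suc k)
    have nz: "real k + c \<noteq> 0" "pochhammer c k \<noteq> 0"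
      using c by (auto simp: pochhammer_eq_0_iff)
    have "coeff p (Suc k) = (real k - real N) * (real k + b) * coeff p k / ((real k + 1) * (real k + c))"
      using rec[of k] nz by (simp add: nonzero_eq_divide_eq mult_ac)
    then show ?case using nz unfolding Suc.IH
      by (simp add: pochhammer_Suc field_simps)
  qed simp
  have "coeff p k = 0" if "k > N" for k
    using that by (subst coef) (simp add: pochhammer_of_nat_eq_0_iff)
  then have "degree p \<le> N" by (rule degree_le[rule_format]) simp
  then have "poly p z = (\<Sum>k\<le>N. coeff p k * z ^ k)"
    by (simp add: poly_altdef) (rule sum.mono_neutral_left, auto simp: coeff_eq_0)
  also have "\<dots> = poly p 0 * hyp2F1 (- real N) b c z"
    unfolding hyp2F1_terminating sum_distrib_left
    by (intro sum.cong refl, subst coef) (simp add: poly_0_coeff_0)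
  finally show ?thesis by (simp add: b_def)
qed


text \<open>Being polynomial is carried as a property of functions, closed under the operations
  used, so that the large sums below never have to be written as elements of
  \<open>real poly\<close>.\<close>

definition poly_fun :: "(real \<Rightarrow> real) \<Rightarrow> bool" where
  "poly_fun f \<longleftrightarrow> (\<exists>p. \<forall>x. f x = poly p x)"

lemma poly_fun_const: "poly_fun (\<lambda>x. c)"
  unfolding poly_fun_def by (rule exI[of _ "[:c:]"]) simp

lemma poly_fun_id: "poly_fun (\<lambda>x. x)"
  unfolding poly_fun_def by (rule exI[of _ "[:0, 1:]"]) simp

lemma poly_fun_add: "poly_fun f \<Longrightarrow> poly_fun g \<Longrightarrow> poly_fun (\<lambda>x. f x + g x)"
  unfolding poly_fun_def by (elim exE, rule_tac x="p + pa" in exI) simp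

lemma poly_fun_diff: "poly_fun f \<Longrightarrow> poly_fun g \<Longrightarrow> poly_fun (\<lambda>x. f x - g x)"
  unfolding poly_fun_def by (elim exE, rule_tac x="p - pa" in exI) simp

lemma poly_fun_mult: "poly_fun f \<Longrightarrow> poly_fun g \<Longrightarrow> poly_fun (\<lambda>x. f x * g x)"
  unfolding poly_fun_def by (elim exE, rule_tac x="p * pa" in exI) simp

lemma poly_fun_power: "poly_fun f \<Longrightarrow> poly_fun (\<lambda>x. f x ^ n)"
  unfolding poly_fun_def by (elim exE, rule_tac x="p ^ n" in exI) simp

lemma poly_fun_sum: "(\<And>i. i \<in> A \<Longrightarrow> poly_fun (f i)) \<Longrightarrow> poly_fun (\<lambda>x. \<Sum>i\<in>A. f i x)"
  by (induction A rule: infinite_finite_induct) (auto intro: poly_fun_const poly_fun_add)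

lemma poly_fun_if: "poly_fun f \<Longrightarrow> poly_fun g \<Longrightarrow> poly_fun (\<lambda>x. if b then f x else g x)"
  by (cases b) auto

lemma poly_fun_compose: "poly_fun f \<Longrightarrow> poly_fun g \<Longrightarrow> poly_fun (\<lambda>x. f (g x))"
  unfolding poly_fun_def by (elim exE, rule_tac x="pcompose p pa" in exI) (simp add: poly_pcompose)

lemmas poly_fun_intros = poly_fun_const poly_fun_id poly_fun_add poly_fun_diff poly_fun_mult
  poly_fun_power poly_fun_sum poly_fun_if

lemma poly_fun_gegenbauer_deriv: "poly_fun (gegenbauer_deriv i M l)"
  unfolding gegenbauer_deriv_def by (intro poly_fun_intros)

text \<open>The substitution x = 1 - 2z gives the hypergeometric equation and moves the
  normalisation point x = 1 to z = 0. Explicit derivatives \<open>F1\<close> and \<open>F2\<close>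
  are tied to \<open>pderiv\<close> by uniqueness of derivatives.\<close>

lemma ultraspherical_ode_unique:
  assumes c: "c > 0" and F: "poly_fun F"
    and F1: "\<And>x. (F has_real_derivative F1 x) (at x)"
    and F2: "\<And>x. (F1 has_real_derivative F2 x) (at x)"
    and ode: "\<And>x. (1 - x\<^sup>2) * F2 x - 2 * c * x * F1 x + real N * (real N + 2 * c - 1) * F x = 0"
  shows "F x = F 1 * hyp2F1 (- real N) (real N + 2 * c - 1) c ((1 - x) / 2)"
proof -
  have "poly_fun (\<lambda>z. F (1 - 2 * z))"
    by (intro poly_fun_compose[OF F] poly_fun_intros)
  then obtain p where p: "\<And>z. F (1 - 2 * z) = poly p z" by (auto simp: poly_fun_def)
  have p1: "poly (pderiv p) z = -2 * F1 (1 - 2 * z)" for z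
  proof (rule DERIV_unique)
    show "(poly p has_real_derivative poly (pderiv p) z) (at z)" by (rule poly_DERIV)
    have "((\<lambda>z. F (1 - 2 * z)) has_real_derivative F1 (1 - 2 * z) * (-2)) (at z)"
      by (rule DERIV_chain2[OF F1]) (auto intro!: derivative_eq_intros)
    moreover have "(\<lambda>z. F (1 - 2 * z)) = poly p" by (simp add: fun_eq_iff p)
    ultimately show "(poly p has_real_derivative -2 * F1 (1 - 2 * z)) (at z)"
      by (simp add: mult.commute)
  qed
  have p2: "poly (pderiv (pderiv p)) z = 4 * F2 (1 - 2 * z)" for z
  proof (rule DERIV_unique)
    show "(poly (pderiv p) has_real_derivative poly (pderiv (pderiv p)) z) (at z)"
      by (rule poly_DERIV)
    have "((\<lambda>z. F1 (1 - 2 * z)) has_real_derivative F2 (1 - 2 * z) * (-2)) (at z)"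
      by (rule DERIV_chain2[OF F2]) (auto intro!: derivative_eq_intros)
    from DERIV_cmult[OF this, of "-2"]
    have "((\<lambda>z. -2 * F1 (1 - 2 * z)) has_real_derivative 4 * F2 (1 - 2 * z)) (at z)"
      by (simp add: mult.commute)
    moreover have "(\<lambda>z. -2 * F1 (1 - 2 * z)) = poly (pderiv p)" by (simp add: fun_eq_iff p1)
    ultimately show "(poly (pderiv p) has_real_derivative 4 * F2 (1 - 2 * z)) (at z)"
      by simp
  qed
  have "z * (1 - z) * poly (pderiv (pderiv p)) z + c * (1 - 2 * z) * poly (pderiv p) z
       + real N * (real N + 2 * c - 1) * poly p z = 0" for z
    using ode[of "1 - 2 * z"] unfolding p1 p2 p[symmetric]
    by (simp add: power2_eq_square algebra_simps)
  from hypergeometric_ode_unique[OF c this]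
  have "poly p ((1 - x) / 2)
    = poly p 0 * hyp2F1 (- real N) (real N + 2 * c - 1) c ((1 - x) / 2)" .
  moreover have "poly p ((1 - x) / 2) = F x" "poly p 0 = F 1"
    using p[of "(1 - x) / 2"] p[of 0] by (simp_all add: field_simps)
  ultimately show ?thesis by simp
qed

lemma gegenbauer_deriv_0_eq:
  assumes g: "g > 0"
  shows "gegenbauer_deriv 0 N g x = Gamma g * pochhammer (2 * g) N / fact N
     * hyp2F1 (- real N) (real N + 2 * g) (g + 1/2) ((1 - x) / 2)"
proof -
  have "gegenbauer_deriv 0 N g x = gegenbauer_deriv 0 N g 1
     * hyp2F1 (- real N) (real N + 2 * (g + 1/2) - 1) (g + 1/2) ((1 - x) / 2)"
  proof (rule ultraspherical_ode_unique[where ?F1.0 = "gegenbauer_deriv 1 N g" and ?F2.0 = "gegenbauer_deriv 2 N g"])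
    show "(gegenbauer_deriv 0 N g has_real_derivative gegenbauer_deriv 1 N g x) (at x)" for x
      using gegenbauer_deriv_has_derivative[of 0 N g x] by simp
    show "(gegenbauer_deriv 1 N g has_real_derivative gegenbauer_deriv 2 N g x) (at x)" for x
      using gegenbauer_deriv_has_derivative[of 1 N g x] by (simp add: numeral_2_eq_2)
    show "(1 - x\<^sup>2) * gegenbauer_deriv 2 N g x - 2 * (g + 1/2) * x * gegenbauer_deriv 1 N g x
      + real N * (real N + 2 * (g + 1/2) - 1) * gegenbauer_deriv 0 N g x = 0" for x
      using gegenbauer_deriv_ode[OF g, of x N] by (simp add: algebra_simps)
  qed (use g poly_fun_gegenbauer_deriv in auto)
  then show ?thesis using gegenbauer_deriv_at_1[OF g, of N] by simp
qed

text \<open>A single term w^n G(xy) does not solve the equation; the last claim isolates its defect,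
  in a form whose two halves cancel against the neighbouring terms. The truncated exponents n - 1
  and n - 2 are harmless since they come with the factors n and n(n - 1).\<close>

lemma product_term_ode:
  fixes g y :: real and n N :: nat
  assumes g: "g > 0" and n: "2 * n \<le> N"
  defines "G i x \<equiv> gegenbauer_deriv i (N - 2 * n) (g + 2 * real n) (x * y)"
    and "w x \<equiv> (1 - x\<^sup>2) * (1 - y\<^sup>2)"
  defines "h x \<equiv> w x ^ n * G 0 x"
    and "h1 x \<equiv> real n * w x ^ (n - 1) * (- 2 * x * (1 - y\<^sup>2)) * G 0 x + w x ^ n * y * G 1 x"
    and "h2 x \<equiv> real n * real (n - 1) * w x ^ (n - 2) * (4 * x\<^sup>2 * (1 - y\<^sup>2)\<^sup>2) * G 0 x
       - 2 * real n * w x ^ (n - 1) * (1 - y\<^sup>2) * G 0 x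
       - 4 * real n * w x ^ (n - 1) * x * (1 - y\<^sup>2) * y * G 1 x + w x ^ n * y\<^sup>2 * G 2 x"
  shows "(h has_real_derivative h1 x) (at x)" "(h1 has_real_derivative h2 x) (at x)"
    "(1 - x\<^sup>2) * h2 x - (2 * g + 1) * x * h1 x + real N * (real N + 2 * g) * h x
      = (1 - y\<^sup>2) * (4 * real n * (real n + g - 1/2) * w x ^ (n - 1) * G 0 x - w x ^ n * G 2 x)"
proof -
  have dG: "(G i has_real_derivative G (Suc i) x * y) (at x)" for i x
    unfolding G_def by (rule DERIV_chain2[OF gegenbauer_deriv_has_derivative]) (auto intro!: derivative_eq_intros)
  have dw: "(w has_real_derivative - 2 * x * (1 - y\<^sup>2)) (at x)" for x
    unfolding w_def by (auto intro!: derivative_eq_intros)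
  have d0: "(G 0 has_real_derivative G 1 x * y) (at x)"
    and d1: "(G 1 has_real_derivative G 2 x * y) (at x)" for x
    using dG[of 0 x] dG[of 1 x] by (simp_all add: numeral_2_eq_2)
  have dwp: "((\<lambda>x. w x ^ k) has_real_derivative real k * w x ^ (k - 1) * (- 2 * x * (1 - y\<^sup>2))) (at x)"
    for k x
    by (rule DERIV_cong[OF DERIV_power[OF dw]]) (simp add: mult_ac)
  show "(h has_real_derivative h1 x) (at x)"
    unfolding h_def h1_def
    by (rule DERIV_cong[OF DERIV_mult[OF dwp d0]]) (simp add: algebra_simps)
  have "((\<lambda>x. real n * w x ^ (n - 1) * (- 2 * x * (1 - y\<^sup>2))) has_real_derivative
      real n * (real (n - 1) * w x ^ (n - 2) * (- 2 * x * (1 - y\<^sup>2))) * (- 2 * x * (1 - y\<^sup>2))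
        + real n * w x ^ (n - 1) * (- 2 * (1 - y\<^sup>2))) (at x)"
    by (rule derivative_eq_intros dwp refl)+ (simp add: numeral_2_eq_2)
  from DERIV_add[OF DERIV_mult[OF this d0] DERIV_mult[OF DERIV_mult[OF dwp DERIV_const] d1]]
  show "(h1 has_real_derivative h2 x) (at x)"
    unfolding h1_def
    by (rule DERIV_cong) (simp add: h2_def algebra_simps power2_eq_square)
  define z where "z = x * y"
  define A where "A = real n * w x ^ (n - 1)"
  define B where "B = real n * real (n - 1) * w x ^ (n - 2)"
  define W where "W = w x ^ n"
  \<comment> \<open>Multiplying by w raises the lower powers. The zero prefactors keep both rules
    valid for n = 0 and n = 1, so no case distinction is needed afterwards.\<close>
  have AW: "w x * A = real n * W" unfolding A_def W_def by (cases n) auto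
  have BA: "w x * B = (real n - 1) * A"
  proof -
    have "n = 0 \<or> n = 1 \<or> (\<exists>m. n = Suc (Suc m))" by (metis One_nat_def not0_implies_Suc)
    then show ?thesis unfolding A_def B_def by (auto simp: algebra_simps)
  qed
  have M: "real (N - 2 * n) = real N - 2 * real n" using n by (simp add: of_nat_diff)
  have ode: "(1 - z\<^sup>2) * G 2 x - (2 * (g + 2 * real n) + 1) * z * G 1 x
     + (real N - 2 * real n) * (real N + 2 * real n + 2 * g) * G 0 x = 0"
    using gegenbauer_deriv_ode[of "g + 2 * real n" z "N - 2 * n"] g
    unfolding G_def z_def M by (simp add: algebra_simps)
  have h: "h x = W * G 0 x"
    and h1: "h1 x = A * (- 2 * x * (1 - y\<^sup>2)) * G 0 x + W * y * G 1 x"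
    and h2: "h2 x = B * (4 * x\<^sup>2 * (1 - y\<^sup>2)\<^sup>2) * G 0 x - 2 * A * (1 - y\<^sup>2) * G 0 x
       - 4 * A * x * (1 - y\<^sup>2) * y * G 1 x + W * y\<^sup>2 * G 2 x"
    unfolding h_def h1_def h2_def A_def B_def W_def by auto
  have w: "w x = (1 - x\<^sup>2) * (1 - y\<^sup>2)" by (simp add: w_def)
  have eqs: "(1 - x\<^sup>2) * (1 - y\<^sup>2) * B = (real n - 1) * A"
    "(1 - x\<^sup>2) * (1 - y\<^sup>2) * A = real n * W"
    using AW BA by (simp_all add: w)
  have "(1 - x\<^sup>2) * h2 x - (2 * g + 1) * x * h1 x + real N * (real N + 2 * g) * h x
      = (1 - y\<^sup>2) * (4 * (real n + g - 1/2) * A * G 0 x - W * G 2 x)"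
  proof -
    define P where "P = x\<^sup>2 * (1 - y\<^sup>2) * A"
    have t0: "(1 - x\<^sup>2) * h2 x = 4 * x\<^sup>2 * (1 - y\<^sup>2) * ((1 - x\<^sup>2) * (1 - y\<^sup>2) * B) * G 0 x
        - 2 * ((1 - x\<^sup>2) * (1 - y\<^sup>2) * A) * G 0 x
        - 4 * ((1 - x\<^sup>2) * (1 - y\<^sup>2) * A) * z * G 1 x + (y\<^sup>2 - z\<^sup>2) * W * G 2 x"
      unfolding h2 z_def by (simp add: algebra_simps power2_eq_square)
    have t1: "(1 - x\<^sup>2) * h2 x = 4 * (real n - 1) * P * G 0 x - 2 * real n * W * G 0 x
        - 4 * real n * W * z * G 1 x + (y\<^sup>2 - z\<^sup>2) * W * G 2 x"
      unfolding t0 eqs P_def by simp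
    have t2: "x * h1 x = - 2 * P * G 0 x + W * z * G 1 x"
      unfolding h1 z_def P_def by (simp add: algebra_simps power2_eq_square)
    \<comment> \<open>Writing x^2 as 1 - (1 - x^2) removes the remaining explicit x. What is left
      beyond the defect is W times the Gegenbauer equation at z = xy with degree N - 2n and
      parameter g + 2n.\<close>
    have P: "P = (1 - y\<^sup>2) * A - real n * W"
      unfolding P_def eqs(2)[symmetric] by (simp add: algebra_simps)
    have "(1 - x\<^sup>2) * h2 x - (2 * g + 1) * (x * h1 x) + real N * (real N + 2 * g) * h x
      - (1 - y\<^sup>2) * (4 * (real n + g - 1/2) * A * G 0 x - W * G 2 x)
      = W * ((1 - z\<^sup>2) * G 2 x - (2 * (g + 2 * real n) + 1) * z * G 1 x
       + (real N - 2 * real n) * (real N + 2 * real n + 2 * g) * G 0 x)"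
      unfolding t1 t2 h P by (simp add: algebra_simps)
    then show ?thesis unfolding ode by (simp add: mult.assoc)
  qed
  then show "(1 - x\<^sup>2) * h2 x - (2 * g + 1) * x * h1 x + real N * (real N + 2 * g) * h x
      = (1 - y\<^sup>2) * (4 * real n * (real n + g - 1/2) * w x ^ (n - 1) * G 0 x - w x ^ n * G 2 x)"
    unfolding A_def W_def by (simp add: algebra_simps)
qed


text \<open>For g = alpha + 1/2 the weights are those of the target series; the factor Gamma(g + 2n)
  sits inside \<open>gegenbauer_deriv\<close>.\<close>

definition ultra_product_kernel :: "nat \<Rightarrow> real \<Rightarrow> real \<Rightarrow> real \<Rightarrow> real" where
  "ultra_product_kernel N g x y = (\<Sum>n\<le>N. if 2 * n \<le> N then
     ((1 - x\<^sup>2) * (1 - y\<^sup>2)) ^ n / (fact n * Gamma (g + 1/2 + real n))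
       * gegenbauer_deriv 0 (N - 2 * n) (g + 2 * real n) (x * y) else 0)"

lemma ultra_product_kernel_eq:
  assumes g: "g > 0"
  shows "ultra_product_kernel N g x y
    = Gamma g * pochhammer (2 * g) N / (fact N * Gamma (g + 1/2))
      * hyp2F1 (- real N) (real N + 2 * g) (g + 1/2) ((1 - x) / 2)
      * hyp2F1 (- real N) (real N + 2 * g) (g + 1/2) ((1 - y) / 2)"
proof -
  define c where "c n = 1 / (fact n * Gamma (g + 1/2 + real n))" for n
  define G where "G n i x = gegenbauer_deriv i (N - 2 * n) (g + 2 * real n) (x * y)" for n i x
  define w where "w x = (1 - x\<^sup>2) * (1 - y\<^sup>2)" for x
  define h where "h n x = w x ^ n * G n 0 x" for n x
  define h1 where "h1 n x = real n * w x ^ (n - 1) * (- 2 * x * (1 - y\<^sup>2)) * G n 0 x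
     + w x ^ n * y * G n 1 x" for n x
  define h2 where "h2 n x = real n * real (n - 1) * w x ^ (n - 2) * (4 * x\<^sup>2 * (1 - y\<^sup>2)\<^sup>2) * G n 0 x
       - 2 * real n * w x ^ (n - 1) * (1 - y\<^sup>2) * G n 0 x
       - 4 * real n * w x ^ (n - 1) * x * (1 - y\<^sup>2) * y * G n 1 x + w x ^ n * y\<^sup>2 * G n 2 x" for n x
  define F where "F x = (\<Sum>n\<in>{n. 2 * n \<le> N}. c n * h n x)" for x
  define F1 where "F1 x = (\<Sum>n\<in>{n. 2 * n \<le> N}. c n * h1 n x)" for x
  define F2 where "F2 x = (\<Sum>n\<in>{n. 2 * n \<le> N}. c n * h2 n x)" for x
  note term_ode = product_term_ode[OF g, of _ N y, folded G_def w_def, folded h_def h1_def h2_def]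
  have set: "{n. 2 * n \<le> N} = {..N div 2}" by auto
  have K: "ultra_product_kernel N g x y = F x" for x
    unfolding ultra_product_kernel_def F_def
    by (rule sum.mono_neutral_cong_right) (auto simp: c_def h_def w_def G_def)
  have "F x = F 1 * hyp2F1 (- real N) (real N + 2 * (g + 1/2) - 1) (g + 1/2) ((1 - x) / 2)"
  proof (rule ultraspherical_ode_unique)
    show "poly_fun F"
      unfolding F_def h_def w_def G_def
      by (intro poly_fun_intros poly_fun_compose[OF poly_fun_gegenbauer_deriv])
    show "(F has_real_derivative F1 x) (at x)" for x
      unfolding F_def F1_def by (intro DERIV_sum DERIV_cmult term_ode(1)) auto
    show "(F1 has_real_derivative F2 x) (at x)" for x
      unfolding F1_def F2_def by (intro DERIV_sum DERIV_cmult term_ode(2)) auto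
    fix x
    \<comment> \<open>The positive half of the defect of the n-th term. The negative half of that
      term equals the positive half of the next one, because a second derivative is 4 times the
      polynomial of parameter l + 2 and Gamma(g + 1/2 + n) advances by one step.\<close>
    define V where "V n = (if 2 * n \<le> N then
      4 * c n * real n * (real n + g - 1/2) * w x ^ (n - 1) * G n 0 x else 0)" for n
    have step: "c n * (w x ^ n * G n 2 x) = V (Suc n)" if "2 * n \<le> N" for n
    proof (cases "2 * Suc n \<le> N")
      case True
      then obtain i where i: "N = 2 * Suc n + i" by (auto simp: le_iff_add)
      have "G n 2 x = 4 * G (Suc n) 0 x"
        using gegenbauer_deriv_2_eq[of i "g + 2 * real n" "x * y"] by (simp add: G_def i algebra_simps)
      moreover define q where "q = g + 1/2 + real n"
      have q: "q > 0" using g by (simp add: q_def)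
      have "g + 1/2 + real (Suc n) = q + 1" by (simp add: q_def)
      then have "Gamma (g + 1/2 + real (Suc n)) = q * Gamma q"
        using Gamma_real_plus1[OF q] by metis
      moreover have "4 * real (Suc n) + 4 * g - 2 = 4 * q" "g + 1/2 + real n = q"
        by (simp_all add: q_def)
      ultimately show ?thesis using True q
        by (simp add: V_def c_def fact_Suc del: of_nat_Suc)
    next
      case False
      then have "N - 2 * n < 2" by auto
      then show ?thesis using False by (simp add: V_def G_def gegenbauer_deriv_2_small)
    qed
    have "(1 - x\<^sup>2) * F2 x - (2 * g + 1) * x * F1 x + real N * (real N + 2 * g) * F x
      = (\<Sum>n | 2 * n \<le> N. c n * ((1 - x\<^sup>2) * h2 n x - (2 * g + 1) * x * h1 n x
           + real N * (real N + 2 * g) * h n x))"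
      unfolding F_def F1_def F2_def
      by (simp add: sum_distrib_left sum.distrib sum_subtractf algebra_simps)
    also have "\<dots> = (\<Sum>n | 2 * n \<le> N. (1 - y\<^sup>2) * (V n - V (Suc n)))"
    proof (intro sum.cong refl)
      fix n assume "n \<in> {n. 2 * n \<le> N}"
      then have n: "2 * n \<le> N" by simp
      show "c n * ((1 - x\<^sup>2) * h2 n x - (2 * g + 1) * x * h1 n x
           + real N * (real N + 2 * g) * h n x) = (1 - y\<^sup>2) * (V n - V (Suc n))"
      proof -
        have t3: "(1 - x\<^sup>2) * h2 n x - (2 * g + 1) * x * h1 n x + real N * (real N + 2 * g) * h n x
          = (1 - y\<^sup>2) * (4 * real n * (real n + g - 1/2) * w x ^ (n - 1) * G n 0 x - w x ^ n * G n 2 x)"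
          using product_term_ode(3)[OF g n, of x y]
          unfolding G_def w_def h_def h1_def h2_def .
        show ?thesis
          unfolding t3 step[OF n, symmetric] right_diff_distrib[of "1 - y\<^sup>2"]
          using n by (simp add: V_def algebra_simps)
      qed
    qed
    \<comment> \<open>Both ends vanish: \<open>V 0\<close> by the factor n, the upper end because
      its index exceeds N/2.\<close>
    also have "\<dots> = (1 - y\<^sup>2) * (V 0 - V (Suc (N div 2)))"
      unfolding set sum_distrib_left[symmetric] sum_telescope ..
    also have "\<dots> = 0" by (simp add: V_def)
    finally show "(1 - x\<^sup>2) * F2 x - 2 * (g + 1/2) * x * F1 x
      + real N * (real N + 2 * (g + 1/2) - 1) * F x = 0"
      by (simp add: algebra_simps)
  qed (use g in auto)
  moreover have "F 1 = gegenbauer_deriv 0 N g y / Gamma (g + 1/2)"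
  proof -
    have "F 1 = (\<Sum>n\<in>{0}. c n * h n 1)"
      unfolding F_def by (rule sum.mono_neutral_right) (auto simp: h_def w_def set)
    then show ?thesis by (simp add: c_def h_def G_def)
  qed
  ultimately show ?thesis
    unfolding K gegenbauer_deriv_0_eq[OF g, of N y] by simp
qed

section \<open>Norms of the Jacobi polynomials\<close>

lemma has_integral_beta_moment:
  fixes \<alpha> :: real
  assumes "\<alpha> > -1"
  shows "((\<lambda>z. z ^ i * (1 - z) ^ j * (z * (1 - z)) powr \<alpha>) has_integral
     Beta (\<alpha> + 1 + real i) (\<alpha> + 1 + real j)) {0..1}"
proof (rule has_integral_spike_finite[OF _ _ has_integral_Beta_real])
  show "finite {0, 1 :: real}" by simp
  fix z :: real assume z: "z \<in> {0..1} - {0, 1}"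
  then have *: "z > 0" "1 - z > 0" by auto
  have "z ^ i = z powr real i" "(1 - z) ^ j = (1 - z) powr real j"
    using * by (simp_all add: powr_realpow)
  moreover have "(z * (1 - z)) powr \<alpha> = z powr \<alpha> * (1 - z) powr \<alpha>"
    using * by (simp add: powr_mult)
  ultimately show "z ^ i * (1 - z) ^ j * (z * (1 - z)) powr \<alpha>
     = z powr (\<alpha> + 1 + real i - 1) * (1 - z) powr (\<alpha> + 1 + real j - 1)"
    by (simp add: powr_add)
qed (use assms in auto)

text \<open>Integrating termwise leaves a terminating series that Chu-Vandermonde sums to a multiple
  of (j - N + 1)_N, which is 0 for j < N and N! for j = N. Powers of 1 - z are essential: powers of
  z would add a third parameter pair to the series.\<close>

lemma hyp2F1_moment:
  fixes \<alpha> :: real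
  assumes a: "\<alpha> > -1" and jN: "j \<le> N"
  shows "((\<lambda>z. hyp2F1 (- real N) (real N + 2 * \<alpha> + 1) (\<alpha> + 1) z * (1 - z) ^ j * (z * (1 - z)) powr \<alpha>)
     has_integral (if j = N then Beta (\<alpha> + 1) (\<alpha> + 1 + real N) * fact N
        / pochhammer (2 * \<alpha> + 2 + real N) N else 0)) {0..1}"
proof -
  define b c d where "b = real N + 2 * \<alpha> + 1" and "c = \<alpha> + 1" and "d = 2 * \<alpha> + 2 + real j"
  have cd: "c > 0" "d > 0" using a by (auto simp: c_def d_def)
  define q where "q k = pochhammer (- real N) k * pochhammer b k / (pochhammer c k * fact k)" for k
  have "((\<lambda>z. \<Sum>k\<le>N. q k * (z ^ k * (1 - z) ^ j * (z * (1 - z)) powr \<alpha>)) has_integral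
     (\<Sum>k\<le>N. q k * Beta (\<alpha> + 1 + real k) (\<alpha> + 1 + real j))) {0..1}"
    by (intro has_integral_sum has_integral_mult_right has_integral_beta_moment a) auto
  moreover have "(\<lambda>z. \<Sum>k\<le>N. q k * (z ^ k * (1 - z) ^ j * (z * (1 - z)) powr \<alpha>))
     = (\<lambda>z. hyp2F1 (- real N) b c z * (1 - z) ^ j * (z * (1 - z)) powr \<alpha>)"
    unfolding hyp2F1_terminating q_def by (simp add: sum_distrib_right mult.assoc)
  moreover have "(\<Sum>k\<le>N. q k * Beta (\<alpha> + 1 + real k) (\<alpha> + 1 + real j))
      = Beta c (c + real j) * (\<Sum>k = 0..N. (pochhammer b k * pochhammer (- real N) k) /
    (of_nat (fact k) * pochhammer d k))"
  proof -
    have "q k * Beta (\<alpha> + 1 + real k) (\<alpha> + 1 + real j) = Beta c (c + real j)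
       * ((pochhammer b k * pochhammer (- real N) k) / (of_nat (fact k) * pochhammer d k))" for k
    proof -
      have g: "Gamma (c + real k) = Gamma c * pochhammer c k"
        "Gamma (d + real k) = Gamma d * pochhammer d k"
        using cd by (simp_all add: pochhammer_Gamma nonpos_Ints_def Gamma_eq_zero_iff)
      have *: "\<alpha> + 1 + real k = c + real k" "\<alpha> + 1 + real j = c + real j"
         "c + real k + (c + real j) = d + real k" "c + (c + real j) = d"
        by (auto simp: c_def d_def)
      have gen: "x * y / (p * f) * (u * p * v / (w * e)) = u * v / w * (y * x / (f * e))"
        if "p > 0" for x y p f u v w e :: real
      proof -
        have "x * y / (p * f) * (u * p * v / (w * e)) = p / p * (u * v / w * (y * x / (f * e)))"
          by (simp only: divide_inverse inverse_mult_distrib mult_ac)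
        then show ?thesis using that by simp
      qed
      have "pochhammer c k > 0" using cd by (simp add: pochhammer_pos)
      then show ?thesis unfolding Beta_def * g q_def of_nat_fact by (rule gen)
    qed
    then show ?thesis by (simp add: sum_distrib_left atMost_atLeast0)
  qed
  moreover have "(\<Sum>k = 0..N. (pochhammer b k * pochhammer (- real N) k) /
    (of_nat (fact k) * pochhammer d k)) = pochhammer (d - b) N / pochhammer d N"
    by (rule Vandermonde_pochhammer) (use cd in auto)
  moreover have "d - b = - real (N - j) + 1"
    using jN by (simp add: d_def b_def)
  moreover have "pochhammer (- real (N - j) + 1) N = (if j = N then fact N else 0)"
  proof (cases "j = N")
    case False
    then have "- real (N - j) + 1 = - real (N - j - 1)" using jN by (simp add: of_nat_diff)
    moreover have "N - j - 1 < N" using jN False by auto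
    ultimately show ?thesis using False
      by (simp add: pochhammer_of_nat_eq_0_iff del: of_nat_diff)
  qed (simp add: pochhammer_fact)
  ultimately have "((\<lambda>z. hyp2F1 (- real N) b c z * (1 - z) ^ j * (z * (1 - z)) powr \<alpha>)
      has_integral Beta c (c + real j) * ((if j = N then fact N else 0) / pochhammer d N)) {0..1}"
    by (simp only:)
  moreover have "Beta c (c + real j) * ((if j = N then fact N else 0) / pochhammer d N)
      = (if j = N then Beta c (c + real N) * fact N
        / pochhammer (2 * \<alpha> + 2 + real N) N else 0)"
    by (simp add: d_def)
  ultimately show ?thesis unfolding b_def c_def by (simp only:)
qed

text \<open>One of the two factors is expanded in powers of 1 - z. Orthogonality removes all powers
  below N, so only the coefficient of (1 - z)^N enters, and this is (-1)^N times the coefficient of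
  z^N.\<close>

lemma hyp2F1_norm:
  fixes \<alpha> :: real
  assumes a: "\<alpha> > -1"
  shows "((\<lambda>z. (hyp2F1 (- real N) (real N + 2 * \<alpha> + 1) (\<alpha> + 1) z)\<^sup>2 * (z * (1 - z)) powr \<alpha>)
     has_integral pochhammer (real N + 2 * \<alpha> + 1) N / pochhammer (\<alpha> + 1) N
       * (Beta (\<alpha> + 1) (\<alpha> + 1 + real N) * fact N / pochhammer (2 * \<alpha> + 2 + real N) N)) {0..1}"
proof -
  define b c where "b = real N + 2 * \<alpha> + 1" and "c = \<alpha> + 1"
  define q where "q k = pochhammer (- real N) k * pochhammer b k / (pochhammer c k * fact k)" for k
  define I where "I = Beta (\<alpha> + 1) (\<alpha> + 1 + real N) * fact N / pochhammer (2 * \<alpha> + 2 + real N) N"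
  define Q where "Q = hyp2F1 (- real N) b c"
  define p where "p = (\<Sum>k\<le>N. monom (q k) k)"
  define r where "r = pcompose p [:1, -1:]"
  have Qp: "Q z = poly p z" for z
    by (simp add: Q_def p_def hyp2F1_terminating q_def poly_sum poly_monom)
  have cp: "coeff p k = (if k \<le> N then q k else 0)" for k
    by (simp add: p_def coeff_sum)
  have dp: "degree p \<le> N" by (rule degree_le) (simp add: cp)
  have dr: "degree r \<le> N" unfolding r_def using degree_pcompose_le[of p "[:1, -1:]"] dp by simp
  have qN: "q N = (-1) ^ N * (pochhammer b N / pochhammer c N)"
    by (simp add: q_def pochhammer_same)
  have rN: "coeff r N = pochhammer b N / pochhammer c N"
  \<comment> \<open>The split avoids showing that the degree is exactly N: if it is smaller, both
    sides are 0.\<close>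
  proof (cases "degree p = N")
    case True
    then have "degree r = N" by (simp add: r_def degree_pcompose)
    then have "coeff r N = lead_coeff r" by simp
    also have "\<dots> = coeff p N * (-1) ^ N" by (simp add: r_def lead_coeff_comp True)
    finally show ?thesis by (simp add: cp qN power_mult_distrib[symmetric])
  next
    case False
    then have "degree p < N" using dp by simp
    then have "q N = 0" using coeff_eq_0[of p N] cp by simp
    moreover have "degree r < N" using \<open>degree p < N\<close> by (simp add: r_def degree_pcompose)
    then have "coeff r N = 0" by (rule coeff_eq_0)
    ultimately show ?thesis by (simp add: qN)
  qed
  have Qr: "Q z = (\<Sum>j\<le>N. coeff r j * (1 - z) ^ j)" for z
  proof -
    have "Q z = poly r (1 - z)" by (simp add: Qp r_def poly_pcompose)
    also have "\<dots> = (\<Sum>j\<le>N. coeff r j * (1 - z) ^ j)"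
      unfolding poly_altdef by (rule sum.mono_neutral_left) (use dr in \<open>auto simp: coeff_eq_0\<close>)
    finally show ?thesis .
  qed
  have "((\<lambda>z. \<Sum>j\<le>N. coeff r j * (Q z * (1 - z) ^ j * (z * (1 - z)) powr \<alpha>)) has_integral
     (\<Sum>j\<le>N. coeff r j * (if j = N then I else 0))) {0..1}"
    unfolding Q_def b_def c_def I_def
    by (intro has_integral_sum has_integral_mult_right hyp2F1_moment a) auto
  moreover have "(\<lambda>z. \<Sum>j\<le>N. coeff r j * (Q z * (1 - z) ^ j * (z * (1 - z)) powr \<alpha>))
     = (\<lambda>z. (Q z)\<^sup>2 * (z * (1 - z)) powr \<alpha>)"
  proof
    fix z
    have "(Q z)\<^sup>2 * (z * (1 - z)) powr \<alpha> = (\<Sum>j\<le>N. coeff r j * (1 - z) ^ j) * (Q z * (z * (1 - z)) powr \<alpha>)"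
      unfolding Qr[symmetric] by (simp add: power2_eq_square)
    then show "(\<Sum>j\<le>N. coeff r j * (Q z * (1 - z) ^ j * (z * (1 - z)) powr \<alpha>))
        = (Q z)\<^sup>2 * (z * (1 - z)) powr \<alpha>"
      unfolding sum_distrib_right by (simp only:) (intro sum.cong, auto)
  qed
  moreover have "(\<Sum>j\<le>N. coeff r j * (if j = N then I else 0)) = coeff r N * I"
    by (simp add: if_distrib cong: if_cong)
  ultimately show ?thesis unfolding rN I_def Q_def b_def c_def by simp
qed

text \<open>Nonnegativity upgrades gauge integrability to absolute integrability, which is what the
  Lebesgue integral needs.\<close>

lemma set_lborel_integral_eq_of_has_integral:
  fixes f :: "real \<Rightarrow> real"
  assumes "f \<in> borel_measurable borel" "S \<in> sets borel" "\<And>x. x \<in> S \<Longrightarrow> f x \<ge> 0"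
    "(f has_integral I) S"
  shows "(LBINT x:S. f x) = I"
proof -
  have "f absolutely_integrable_on S"
    using assms by (intro nonnegative_absolutely_integrable_1) (auto simp: integrable_on_def)
  then have "set_integrable lborel S f"
    using assms unfolding set_integrable_def
    by (subst (asm) integrable_completion) (auto intro!: borel_measurable_indicator)
  then show ?thesis
    using assms(4) set_borel_integral_eq_integral(2)[of S f] by (simp add: integral_unique)
qed

text \<open>The substitution z = (1 - y)/2 reduces this to the hypergeometric norm. It agrees with
  the usual Gamma form through Gamma(2 alpha + 2)/Gamma(2 alpha + N + 1) = (2 alpha + 1)/(2 alpha +
  1)_N.\<close>

lemma ultra_sqnorm_eq:
  fixes \<alpha> :: real
  assumes a: "\<alpha> > -1/2"
  shows "ultra_sqnorm N \<alpha> = (pochhammer (\<alpha> + 1) N / fact N)\<^sup>2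
     * ((\<alpha> + 1/2) * fact N / ((real N + \<alpha> + 1/2) * pochhammer (2 * \<alpha> + 1) N))"
proof -
  define Q where "Q = hyp2F1 (- real N) (real N + 2 * \<alpha> + 1) (\<alpha> + 1)"
  define B where "B = Beta (\<alpha> + 1) (\<alpha> + 1)"
  define I where "I = pochhammer (real N + 2 * \<alpha> + 1) N / pochhammer (\<alpha> + 1) N
       * (Beta (\<alpha> + 1) (\<alpha> + 1 + real N) * fact N / pochhammer (2 * \<alpha> + 2 + real N) N)"
  define P where "P = pochhammer (\<alpha> + 1) N / fact N"
  have B: "B > 0" using a by (simp add: B_def Beta_def)
  have Q: "((\<lambda>z. (Q z)\<^sup>2 * (z * (1 - z)) powr \<alpha>) has_integral I) (cbox 0 1)"
    using hyp2F1_norm[of \<alpha> N] a by (simp add: Q_def I_def)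
  have "((\<lambda>y. (Q ((-1/2) *\<^sub>R y + 1/2))\<^sup>2 * (((-1/2) *\<^sub>R y + 1/2) * (1 - ((-1/2) *\<^sub>R y + 1/2))) powr \<alpha>)
      has_integral (1 / \<bar>-1/2\<bar> ^ DIM(real)) *\<^sub>R I) ((\<lambda>x. (1 / (-1/2)) *\<^sub>R x + -((1 / (-1/2)) *\<^sub>R (1/2))) ` cbox 0 1)"
    by (rule has_integral_affinity[OF Q]) simp
  also have "(\<lambda>x::real. (1 / (-1/2)) *\<^sub>R x + -((1 / (-1/2)) *\<^sub>R (1/2))) ` cbox 0 1 = {-1..1}"
    by (subst image_affinity_cbox) auto
  finally have 1: "((\<lambda>y. (Q ((1 - y) / 2))\<^sup>2 * ((1 - y\<^sup>2) / 4) powr \<alpha>) has_integral 2 * I) {-1..1}"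
  proof -
    have "(-1/2) *\<^sub>R y + 1/2 = (1 - y) / 2" "(1 - y) / 2 * (1 - (1 - y) / 2) = (1 - y\<^sup>2) / 4" for y :: real
      by (simp_all add: field_simps power2_eq_square)
    moreover have "(1 / \<bar>-1/2 :: real\<bar> ^ DIM(real)) *\<^sub>R I = 2 * I" by simp
    moreover assume "((\<lambda>y. (Q ((-1/2) *\<^sub>R y + 1/2))\<^sup>2 * (((-1/2) *\<^sub>R y + 1/2) * (1 - ((-1/2) *\<^sub>R y + 1/2))) powr \<alpha>)
      has_integral (1 / \<bar>-1/2\<bar> ^ DIM(real)) *\<^sub>R I) {-1..1}"
    ultimately show ?thesis by (simp only:)
  qed
  have eq: "P\<^sup>2 / (2 * B) * ((Q ((1 - y) / 2))\<^sup>2 * ((1 - y\<^sup>2) / 4) powr \<alpha>)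
        = (jacobi_P N \<alpha> \<alpha> y)\<^sup>2 * ultra_weight \<alpha> y" if "y \<in> {-1..1}" for y
  proof -
    have "(4::real) powr \<alpha> = 2 powr (2 * \<alpha>)"
      using powr_powr[of 2 2 \<alpha>] by simp
    moreover have "1 - y\<^sup>2 \<ge> 0"
      using that by (simp add: abs_square_le_1 abs_le_iff)
    ultimately have "((1 - y\<^sup>2) / 4) powr \<alpha> = (1 - y\<^sup>2) powr \<alpha> / 2 powr (2 * \<alpha>)"
      by (simp add: powr_divide)
    moreover have "jacobi_P N \<alpha> \<alpha> y = P * Q ((1 - y) / 2)"
    proof -
      have *: "real N + \<alpha> + \<alpha> + 1 = real N + 2 * \<alpha> + 1" by simp
      show ?thesis unfolding jacobi_P_def P_def Q_def * ..
    qed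
    moreover have "2 powr (2 * \<alpha> + 1) = 2 * (2::real) powr (2 * \<alpha>)"
      using powr_add[of 2 "2 * \<alpha>" 1] by simp
    ultimately show ?thesis
      unfolding ultra_weight_def B_def[symmetric] by (simp add: power_mult_distrib) (simp only: mult_ac)
  qed
  have "((\<lambda>y. P\<^sup>2 / (2 * B) * ((Q ((1 - y) / 2))\<^sup>2 * ((1 - y\<^sup>2) / 4) powr \<alpha>)) has_integral
      P\<^sup>2 / (2 * B) * (2 * I)) {-1..1}"
    by (intro has_integral_mult_right 1)
  from has_integral_eq[OF eq this]
  have "((\<lambda>y. (jacobi_P N \<alpha> \<alpha> y)\<^sup>2 * ultra_weight \<alpha> y) has_integral P\<^sup>2 * (I / B)) {-1..1}"
    using B by simp
  then have "ultra_sqnorm N \<alpha> = P\<^sup>2 * (I / B)"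
    unfolding ultra_sqnorm_def
  proof (rule set_lborel_integral_eq_of_has_integral[rotated 3])
    show "(\<lambda>y. (jacobi_P N \<alpha> \<alpha> y)\<^sup>2 * ultra_weight \<alpha> y) \<in> borel_measurable borel"
      unfolding jacobi_P_def ultra_weight_def hyp2F1_terminating by measurable
    show "(jacobi_P N \<alpha> \<alpha> y)\<^sup>2 * ultra_weight \<alpha> y \<ge> 0" for y
      using B by (simp add: ultra_weight_def B_def)
  qed auto
  moreover have "I / B = (\<alpha> + 1/2) * fact N / ((real N + \<alpha> + 1/2) * pochhammer (2 * \<alpha> + 1) N)"
  proof -
    define d where "d = 2 * \<alpha> + 1"
    have d: "d > 0" using a by (simp add: d_def)
    define X Y Z where "X = pochhammer d N" and "Y = pochhammer (d + real N) N"
      and "Z = pochhammer (\<alpha> + 1) N"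
    have pos: "X > 0" "Y > 0" "Z > 0" using a d by (auto simp: X_def Y_def Z_def pochhammer_pos)
    have XY: "X * Y = pochhammer d (2 * N)"
      using pochhammer_product'[of d N N] by (simp add: X_def Y_def mult_2)
    \<comment> \<open>Both products are Pochhammer symbols of length 2N, with bases d + 1 and d.
      Their ratio (d + 2N)/d is where the denominator N + alpha + 1/2 comes from; \<open>Y\<close>
      then cancels against the leading coefficient.\<close>
    have ZZ: "pochhammer (d + 1) N * pochhammer (d + 1 + real N) N = X * Y * (d + 2 * real N) / d"
    proof -
      have "pochhammer (d + 1) N * pochhammer (d + 1 + real N) N = pochhammer (d + 1) (2 * N)"
        using pochhammer_product'[of "d + 1" N N] by (simp add: mult_2)
      moreover have "d * pochhammer (d + 1) (2 * N) = pochhammer d (2 * N) * (d + 2 * real N)"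
        using pochhammer_rec[of d "2 * N"] pochhammer_Suc[of d "2 * N"] by simp
      ultimately show ?thesis using d by (simp add: XY field_simps)
    qed
    have g: "Gamma (\<alpha> + 1 + real N) = Gamma (\<alpha> + 1) * Z"
        "Gamma (d + 1 + real N) = Gamma (d + 1) * pochhammer (d + 1) N"
        using a d by (simp_all add: pochhammer_Gamma nonpos_Ints_def Gamma_eq_zero_iff Z_def)
    have gp: "Gamma (\<alpha> + 1) > 0" "Gamma (d + 1) > 0" using a d by auto
    have p: "pochhammer (d + 1) N > 0" "pochhammer (d + 1 + real N) N > 0"
      using d by (auto intro!: pochhammer_pos)
    have e: "\<alpha> + 1 + (\<alpha> + 1 + real N) = d + 1 + real N" "\<alpha> + 1 + (\<alpha> + 1) = d + 1"
        "2 * \<alpha> + 2 + real N = d + 1 + real N" "real N + 2 * \<alpha> + 1 = d + real N"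
      by (auto simp: d_def)
    have cancel: "Y / Z * (u * (u * Z) / (v * p) * f / r) / (u * u / v) = Y * f / (p * r)"
      if "u > 0" "v > 0" for u v p f r :: real
      using that pos by simp
    have "I / B = Y * fact N / (pochhammer (d + 1) N * pochhammer (d + 1 + real N) N)"
      unfolding I_def B_def Beta_def e g Y_def[symmetric] Z_def[symmetric]
      by (rule cancel[OF gp])
    also have "\<dots> = d * fact N / ((d + 2 * real N) * X)"
      unfolding ZZ using pos d by simp (simp only: mult_ac)
    also have "d + 2 * real N = 2 * (real N + \<alpha> + 1/2)" by (simp add: d_def)
    also have "d * fact N = 2 * ((\<alpha> + 1/2) * fact N)" by (simp add: d_def algebra_simps)
    finally have "I / B = 2 * ((\<alpha> + 1/2) * fact N) / (2 * ((real N + \<alpha> + 1/2) * pochhammer (2 * \<alpha> + 1) N))"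
      unfolding X_def d_def mult.assoc .
    moreover have "2 * u / (2 * v) = u / v" for u v :: real by simp
    ultimately show ?thesis by metis
  qed
  ultimately show ?thesis by (simp add: P_def)
qed

section \<open>Convolution of Gaussian kernels with hitting densities\<close>

text \<open>Used for the Gaussian distribution function in \<open>heat_hitting_convolution\<close>
  and to telescope integrals over unit intervals in \<open>f_T1_theta\<close>.\<close>

lemma continuous_integrable_antiderivative:
  fixes f :: "real \<Rightarrow> real"
  assumes cont: "continuous_on UNIV f" and I: "integrable lborel f"
  obtains \<Phi> where "\<And>u. (\<Phi> has_real_derivative f u) (at u)"
    "(\<Phi> \<longlongrightarrow> (LINT x|lborel. f x)) at_top" "(\<Phi> \<longlongrightarrow> 0) at_bot"
proof -
  define \<Phi> where "\<Phi> u = (LBINT x:{..u}. f x)" for u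
  have int: "set_integrable lborel S f" if "S \<in> sets borel" for S
    unfolding set_integrable_def by (rule integrable_mult_indicator) (use I that in auto)
  have eq: "\<Phi> u = \<Phi> a + integral {a..u} f" if "a \<le> u" for a u
  proof -
    have "{..u} = {..a} \<union> {a<..u}" using that by auto
    then have "\<Phi> u = \<Phi> a + (LBINT x:{a<..u}. f x)"
      unfolding \<Phi>_def by (simp only:) (rule set_integral_Un, auto intro!: int)
    also have "(LBINT x:{a<..u}. f x) = (LBINT x:{a..u}. f x)"
    proof (rule set_integral_null_delta)
      have "sym_diff {a<..u} {a..u} = {a}" using that by auto
      then show "sym_diff {a<..u} {a..u} \<in> null_sets lborel"
        by (simp add: finite_imp_null_set_lborel)
    qed (use I in auto)
    also have "\<dots> = integral {a..u} f"
      by (rule set_borel_integral_eq_integral(2)[OF int]) auto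
    finally show ?thesis .
  qed
  have der: "(\<Phi> has_real_derivative f u) (at u)" for u
  proof -
    have "((\<lambda>x. integral {u-1..x} f) has_real_derivative f u) (at u within {u-1..u+1})"
      by (rule integral_has_real_derivative) (auto intro: continuous_on_subset[OF cont])
    then have "((\<lambda>x. integral {u-1..x} f) has_real_derivative f u) (at u)"
      by (simp add: at_within_Icc_at)
    then have "((\<lambda>x. \<Phi> (u-1) + integral {u-1..x} f) has_real_derivative f u) (at u)"
      by (auto intro!: derivative_eq_intros)
    then show ?thesis
    \<comment> \<open>The splitting of the integral at u - 1 is valid only to the right of u - 1,
      which is still a neighbourhood of u.\<close>
    proof (rule DERIV_cong_ev[THEN iffD1, OF refl _ refl, rotated])
      have "\<forall>\<^sub>F x in nhds u. x \<in> {u - 1<..}" by (rule eventually_nhds_in_open) auto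
      then show "\<forall>\<^sub>F x in nhds u. \<Phi> (u-1) + integral {u-1..x} f = \<Phi> x"
        by eventually_elim (rule eq[symmetric], simp)
    qed
  qed
  have top: "(\<Phi> \<longlongrightarrow> (LINT x|lborel. f x)) at_top"
    unfolding \<Phi>_def set_lebesgue_integral_def by (rule tendsto_integral_at_top) (use I in auto)
  have "((\<lambda>u. \<Phi> 0 - (LBINT x:{u..0}. f x)) \<longlongrightarrow> \<Phi> 0 - \<Phi> 0) at_bot"
    unfolding \<Phi>_def[of 0]
    by (intro tendsto_diff tendsto_const tendsto_set_lebesgue_integral_at_bot int) auto
  moreover have "\<forall>\<^sub>F u in at_bot. \<Phi> 0 - (LBINT x:{u..0}. f x) = \<Phi> u"
    using eventually_le_at_bot[of 0]
  proof eventually_elim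
    case (elim u)
    then show ?case
      using eq[OF elim] set_borel_integral_eq_integral(2)[OF int, of "{u..0}"] by simp
  qed
  ultimately have bot: "(\<Phi> \<longlongrightarrow> 0) at_bot"
    using Lim_transform_eventually by fastforce
  show ?thesis using that[OF der top bot] .
qed

text \<open>The sum of the values at u and -u has derivative 0; it is twice the value at 0, and it
  tends to I at infinity.\<close>

lemma even_antiderivative_at_0:
  fixes f \<Phi> :: "real \<Rightarrow> real"
  assumes der: "\<And>u. (\<Phi> has_real_derivative f u) (at u)"
    and top: "(\<Phi> \<longlongrightarrow> I) at_top" and bot: "(\<Phi> \<longlongrightarrow> 0) at_bot" and even: "\<And>u. f (-u) = f u"
  shows "\<Phi> 0 = I / 2"
proof -
  have "((\<lambda>u. \<Phi> u + \<Phi> (-u)) has_real_derivative 0) (at u)" for u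
    by (rule derivative_eq_intros der DERIV_chain2[OF der] refl)+ (simp add: even)
  then have "\<Phi> u + \<Phi> (-u) = \<Phi> 0 + \<Phi> (-0)" for u
    using DERIV_isconst_all[of "\<lambda>u. \<Phi> u + \<Phi> (-u)" u 0] by simp
  then have "((\<lambda>u. \<Phi> u + \<Phi> (-u)) \<longlongrightarrow> \<Phi> 0 + \<Phi> 0) at_top"
    by (simp add: tendsto_const)
  moreover have "((\<lambda>u. \<Phi> u + \<Phi> (-u)) \<longlongrightarrow> I + 0) at_top"
    by (intro tendsto_add top filterlim_compose[OF bot filterlim_uminus_at_bot_at_top])
  ultimately have "\<Phi> 0 + \<Phi> 0 = I + 0" by (rule tendsto_unique[rotated]) auto
  then show ?thesis by simp
qed

text \<open>The centred Gaussian density of variance u at the point a.\<close>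

definition heat :: "real \<Rightarrow> real \<Rightarrow> real" where
  "heat a u = exp (- (a\<^sup>2 / (2 * u))) / sqrt (2 * pi * u)"

text \<open>The density of the first time at which a standard Brownian motion reaches level b >
  0.\<close>

definition hitting :: "real \<Rightarrow> real \<Rightarrow> real" where
  "hitting b r = b / sqrt (2 * pi * r ^ 3) * exp (- (b\<^sup>2 / (2 * r)))"

text \<open>To be at a + b at time s, a Brownian path must first hit b at some time r and then
  travel the distance a in the remaining time. The proof is calculus: the integrand has an
  elementary antiderivative in terms of the normal distribution function.\<close>

lemma heat_hitting_convolution:
  assumes a: "a \<ge> 0" and b: "b > 0" and s: "s > 0"
  shows "set_integrable lborel {0<..<s} (\<lambda>r. heat a (s - r) * hitting b r)" (is ?I)
    and "(LBINT r:{0<..<s}. heat a (s - r) * hitting b r) = heat (a + b) s" (is ?E)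
proof -
  have "continuous_on UNIV std_normal_density"
    unfolding normal_density_def by (intro continuous_intros) auto
  moreover have N: "integrable lborel std_normal_density" "(LINT x|lborel. std_normal_density x) = 1"
    using integrable_std_normal_moment[of 0] integral_std_normal_moment_even[of 0] by simp_all
  ultimately obtain \<Phi> where \<Phi>: "\<And>u. (\<Phi> has_real_derivative std_normal_density u) (at u)"
    and top: "(\<Phi> \<longlongrightarrow> 1) at_top" and bot: "(\<Phi> \<longlongrightarrow> 0) at_bot"
    using continuous_integrable_antiderivative by metis
  have half: "\<Phi> 0 = 1/2"
    by (rule even_antiderivative_at_0[OF \<Phi> top bot]) (simp add: normal_density_def)
  \<comment> \<open>Chosen so that v w = 1/s. Then a^2/(s - r) + b^2/r equals (a + b)^2/s + (b v - a
    w)^2 and also (b - a)^2/s + (b v + a w)^2; these two completions of the square produce the two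
    terms of \<open>F\<close>.\<close>
  define v where "v r = sqrt (1 / r - 1 / s)" for r
  define w where "w r = sqrt (1 / (s - r) - 1 / s)" for r
  define E1 where "E1 = heat (a + b) s"
  define E2 where "E2 = heat (b - a) s"
  define F where "F r = - (E1 * \<Phi> (b * v r - a * w r) + E2 * \<Phi> (b * v r + a * w r))" for r
  define f where "f r = heat a (s - r) * hitting b r" for r
  have dF: "(F has_real_derivative f r) (at r)" if r: "0 < r" "r < s" for r
  proof -
    have pos: "1 / r - 1 / s > 0" "1 / (s - r) - 1 / s > 0"
      using r by (simp_all add: field_simps)
    define vd where "vd = inverse (v r) / 2 * (- (1 / r\<^sup>2))"
    define wd where "wd = inverse (w r) / 2 * (1 / (s - r)\<^sup>2)"
    have v: "(v has_real_derivative vd) (at r)"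
      unfolding v_def vd_def using pos r
      by (auto intro!: derivative_eq_intros simp: power2_eq_square)
    have w: "(w has_real_derivative wd) (at r)"
      unfolding w_def wd_def using pos r
      by (auto intro!: derivative_eq_intros simp: power2_eq_square)
    have vw: "v r * w r = 1 / s" 
    proof -
      have "(1 / r - 1 / s) * (1 / (s - r) - 1 / s) = (1 / s)\<^sup>2"
        using r s by (simp add: field_simps power2_eq_square)
      then show ?thesis unfolding v_def w_def real_sqrt_mult[symmetric]
        using s by (simp only: real_sqrt_abs) simp
    qed
    have v2: "(v r)\<^sup>2 = 1 / r - 1 / s" "(w r)\<^sup>2 = 1 / (s - r) - 1 / s"
      unfolding v_def w_def using pos by simp_all
    define X where "X = exp (- (a\<^sup>2 / (2 * (s - r)))) * exp (- (b\<^sup>2 / (2 * r)))"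
    have E: "E1 * std_normal_density (b * v r - a * w r) = X / (2 * pi * sqrt s)"
         "E2 * std_normal_density (b * v r + a * w r) = X / (2 * pi * sqrt s)"
    proof -
      have n1: "(b * v r - a * w r)\<^sup>2 = b\<^sup>2 * (v r)\<^sup>2 + a\<^sup>2 * (w r)\<^sup>2 - 2 * a * b * (v r * w r)"
        and n2: "(b * v r + a * w r)\<^sup>2 = b\<^sup>2 * (v r)\<^sup>2 + a\<^sup>2 * (w r)\<^sup>2 + 2 * a * b * (v r * w r)"
        by (simp_all add: power2_eq_square algebra_simps)
      have e1: "- ((a + b)\<^sup>2 / (2 * s)) + - (b * v r - a * w r)\<^sup>2 / 2 = - (a\<^sup>2 / (2 * (s - r))) + - (b\<^sup>2 / (2 * r))"
        and e2: "- ((b - a)\<^sup>2 / (2 * s)) + - (b * v r + a * w r)\<^sup>2 / 2 = - (a\<^sup>2 / (2 * (s - r))) + - (b\<^sup>2 / (2 * r))"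
        unfolding n1 n2 v2 vw using r s
        by (simp_all add: power2_eq_square diff_divide_distrib add_divide_distrib algebra_simps)
      have q: "sqrt (2 * pi * s) * sqrt (2 * pi) = 2 * pi * sqrt s"
      proof -
        have "sqrt (2 * pi) * sqrt (2 * pi) = 2 * pi" by simp
        then show ?thesis unfolding real_sqrt_mult[of "2 * pi" s]
          by (simp only: mult_ac)
      qed
      have "E1 * std_normal_density (b * v r - a * w r) = exp (- ((a + b)\<^sup>2 / (2 * s)))
          * exp (- (b * v r - a * w r)\<^sup>2 / 2) / (sqrt (2 * pi * s) * sqrt (2 * pi))"
        by (simp add: E1_def heat_def std_normal_density_def)
      then show "E1 * std_normal_density (b * v r - a * w r) = X / (2 * pi * sqrt s)"
        unfolding X_def q exp_add[symmetric] e1 .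
      have "E2 * std_normal_density (b * v r + a * w r) = exp (- ((b - a)\<^sup>2 / (2 * s)))
          * exp (- (b * v r + a * w r)\<^sup>2 / 2) / (sqrt (2 * pi * s) * sqrt (2 * pi))"
        by (simp add: E2_def heat_def std_normal_density_def)
      then show "E2 * std_normal_density (b * v r + a * w r) = X / (2 * pi * sqrt s)"
        unfolding X_def q exp_add[symmetric] e2 .
    qed
    have d1: "((\<lambda>r. \<Phi> (b * v r - a * w r)) has_real_derivative
        std_normal_density (b * v r - a * w r) * (b * vd - a * wd)) (at r)"
      by (rule DERIV_chain2[OF \<Phi>]) (intro DERIV_diff DERIV_cmult v w)
    have d2: "((\<lambda>r. \<Phi> (b * v r + a * w r)) has_real_derivative
        std_normal_density (b * v r + a * w r) * (b * vd + a * wd)) (at r)"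
      by (rule DERIV_chain2[OF \<Phi>]) (intro DERIV_add DERIV_cmult v w)
    have "(F has_real_derivative - (E1 * (std_normal_density (b * v r - a * w r) * (b * vd - a * wd))
        + E2 * (std_normal_density (b * v r + a * w r) * (b * vd + a * wd)))) (at r)"
      unfolding F_def by (intro DERIV_minus DERIV_add DERIV_cmult d1 d2)
    \<comment> \<open>Prefactor times density is the same for both terms, so the contributions of w'
      cancel and those of v' double.\<close>
    also have "- (E1 * (std_normal_density (b * v r - a * w r) * (b * vd - a * wd))
        + E2 * (std_normal_density (b * v r + a * w r) * (b * vd + a * wd)))
       = - (X / (2 * pi * sqrt s) * (2 * b * vd))"
    proof -
      have "- (Y * (b * vd - a * wd) + Y * (b * vd + a * wd)) = - (Y * (2 * b * vd))" for Y
        by (simp add: algebra_simps)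
      then show ?thesis unfolding mult.assoc[symmetric] E by (simp only: mult.assoc)
    qed
    also have "\<dots> = f r"
    proof -
      have sv: "sqrt s * v r = sqrt (s - r) / sqrt r"
      proof -
        have "s * (1 / r - 1 / s) = (s - r) / r" using r s by (simp add: field_simps)
        then show ?thesis unfolding v_def
          by (metis real_sqrt_divide real_sqrt_mult)
      qed
      have "f r = b * X / (sqrt (2 * pi * (s - r)) * sqrt (2 * pi * r ^ 3))"
        by (simp add: f_def heat_def hitting_def X_def)
      also have "sqrt (2 * pi * (s - r)) * sqrt (2 * pi * r ^ 3) = 2 * pi * (sqrt (s - r) * (r * sqrt r))"
      proof -
        have r3: "sqrt (r ^ 3) = r * sqrt r"
          using r by (simp add: real_sqrt_mult power3_eq_cube)
        have pp: "sqrt (2 * pi) * sqrt (2 * pi) = 2 * pi" by simp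
        have "p * A * (p * B) = C * (A * B)" if "p * p = C" for p A B C :: real
          using that by auto
        from this[OF pp] show ?thesis
          unfolding real_sqrt_mult[of "2 * pi" "s - r"] real_sqrt_mult[of "2 * pi" "r ^ 3"] r3 .
      qed
      also have "sqrt (s - r) * (r * sqrt r) = r\<^sup>2 * (sqrt s * v r)"
      proof -
        have "r\<^sup>2 / sqrt r = r * sqrt r"
          unfolding power2_eq_square times_divide_eq_right[symmetric]
          using r real_div_sqrt[of r] by simp
        moreover have "r\<^sup>2 * (A / B) = A * (r\<^sup>2 / B)" for A B by simp
        ultimately show ?thesis unfolding sv by metis
      qed
      finally have "f r = b * X / (2 * pi * (r\<^sup>2 * (sqrt s * v r)))" .
      moreover have "- (X / (2 * pi * q) * (2 * b * (inverse u / 2 * - (1 / r\<^sup>2))))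
          = b * X / (2 * pi * (r\<^sup>2 * (q * u)))" for q u
      proof -
        have "2 * b * (inverse u / 2 * - (1 / r\<^sup>2)) = - (b * inverse u / r\<^sup>2)" by simp
        then show ?thesis
          by (simp only: divide_inverse inverse_mult_distrib mult_minus_right minus_minus mult_ac)
      qed
      ultimately show ?thesis unfolding vd_def by (simp only:)
    qed
    finally show ?thesis .
  qed
  have cont: "isCont f r" if "0 < r" "r < s" for r
    unfolding f_def heat_def hitting_def using that
    by (intro continuous_intros) auto
  have v0: "filterlim v at_top (at_right 0)"
  proof -
    have "filterlim (\<lambda>r. - (1 / s) + inverse r) at_top (at_right 0)"
      by (rule filterlim_tendsto_add_at_top[OF tendsto_const filterlim_inverse_at_top_right])
    then have "filterlim (\<lambda>r. 1 / r - 1 / s) at_top (at_right 0)"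
      by (simp add: inverse_eq_divide)
    then show ?thesis unfolding v_def by (rule filterlim_compose[OF sqrt_at_top])
  qed
  have w0: "(w \<longlongrightarrow> 0) (at_right 0)"
  proof -
    have "(w \<longlongrightarrow> sqrt (1 / (s - 0) - 1 / s)) (at_right 0)"
      unfolding w_def using s by (intro tendsto_intros) auto
    then show ?thesis by simp
  qed
  have vs: "(v \<longlongrightarrow> 0) (at_left s)"
  proof -
    have "(v \<longlongrightarrow> sqrt (1 / s - 1 / s)) (at_left s)"
      unfolding v_def using s by (intro tendsto_intros) auto
    then show ?thesis by simp
  qed
  have ws: "filterlim w at_top (at_left s)"
  proof -
    have "filterlim (\<lambda>r. s - r) (at_right 0) (at_left s)"
      unfolding filterlim_at
      by (auto intro!: tendsto_eq_intros simp: eventually_at_filter)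
    then have "filterlim (\<lambda>r. inverse (s - r)) at_top (at_left s)"
      by (rule filterlim_compose[OF filterlim_inverse_at_top_right])
    then have "filterlim (\<lambda>r. - (1 / s) + inverse (s - r)) at_top (at_left s)"
      by (rule filterlim_tendsto_add_at_top[OF tendsto_const])
    then have "filterlim (\<lambda>r. 1 / (s - r) - 1 / s) at_top (at_left s)"
      by (simp add: inverse_eq_divide)
    then show ?thesis unfolding w_def by (rule filterlim_compose[OF sqrt_at_top])
  qed
  have F0: "(F \<longlongrightarrow> - (E1 * 1 + E2 * 1)) (at_right 0)"
  proof -
    have bv: "filterlim (\<lambda>r. b * v r) at_top (at_right 0)"
      using b v0 by (intro filterlim_tendsto_pos_mult_at_top[OF tendsto_const]) auto
    have "((\<lambda>r. - (a * w r)) \<longlongrightarrow> - (a * 0)) (at_right 0)" "((\<lambda>r. a * w r) \<longlongrightarrow> a * 0) (at_right 0)"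
      by (intro tendsto_intros w0)+
    from this[THEN filterlim_tendsto_add_at_top, OF bv]
    have "filterlim (\<lambda>r. b * v r - a * w r) at_top (at_right 0)"
      "filterlim (\<lambda>r. b * v r + a * w r) at_top (at_right 0)" by (simp_all add: add.commute)
    from this[THEN filterlim_compose[OF top]]
    show ?thesis unfolding F_def by (intro tendsto_intros)
  qed
  \<comment> \<open>At s, v tends to 0 and w to infinity, so for a > 0 the arguments separate to the
    two infinities. For a = 0 both tend to 0, and the limit is still -\<open>E2\<close> because the
    two prefactors agree and the distribution function is 1/2 at 0.\<close>
  have Fs: "(F \<longlongrightarrow> - E2) (at_left s)"
  proof (cases "a = 0")
    case True
    have "((\<lambda>r. b * v r) \<longlongrightarrow> b * 0) (at_left s)" by (intro tendsto_intros vs)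
    then have "((\<lambda>r. \<Phi> (b * v r)) \<longlongrightarrow> \<Phi> 0) (at_left s)"
      by (intro isCont_tendsto_compose[OF DERIV_isCont[OF \<Phi>]]) simp
    then have "((\<lambda>r. - (E1 * \<Phi> (b * v r) + E2 * \<Phi> (b * v r))) \<longlongrightarrow> - (E1 * \<Phi> 0 + E2 * \<Phi> 0)) (at_left s)"
      by (intro tendsto_intros)
    moreover have "E1 = E2" using True by (simp add: E1_def E2_def)
    ultimately show ?thesis unfolding F_def True half by simp
  next
    case False
    with a have a: "a > 0" by simp
    have aw: "filterlim (\<lambda>r. a * w r) at_top (at_left s)"
      using a ws by (intro filterlim_tendsto_pos_mult_at_top[OF tendsto_const]) auto
    have bv: "((\<lambda>r. b * v r) \<longlongrightarrow> b * 0) (at_left s)" "((\<lambda>r. - (b * v r)) \<longlongrightarrow> - (b * 0)) (at_left s)"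
      by (intro tendsto_intros vs)+
    from this[THEN filterlim_tendsto_add_at_top, OF aw]
    have "filterlim (\<lambda>r. b * v r + a * w r) at_top (at_left s)"
      and *: "filterlim (\<lambda>r. - (b * v r) + a * w r) at_top (at_left s)" .
    moreover have "filterlim (\<lambda>r. b * v r - a * w r) at_bot (at_left s)"
      using * unfolding filterlim_uminus_at_bot by simp
    ultimately have "((\<lambda>r. \<Phi> (b * v r + a * w r)) \<longlongrightarrow> 1) (at_left s)"
        "((\<lambda>r. \<Phi> (b * v r - a * w r)) \<longlongrightarrow> 0) (at_left s)"
      by (auto intro: filterlim_compose[OF top] filterlim_compose[OF bot])
    then have "(F \<longlongrightarrow> - (E1 * 0 + E2 * 1)) (at_left s)"
      unfolding F_def by (intro tendsto_intros)
    then show ?thesis by simp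
  qed
  \<comment> \<open>Nonnegativity lets the fundamental theorem for improper integrals deliver
    integrability together with the value.\<close>
  have nonneg: "AE r in lborel. ereal 0 < ereal r \<longrightarrow> ereal r < ereal s \<longrightarrow> 0 \<le> f r"
    using b by (auto simp: f_def heat_def hitting_def)
  have l0: "((F \<circ> real_of_ereal) \<longlongrightarrow> - (E1 * 1 + E2 * 1)) (at_right (ereal 0))"
    using F0 unfolding ereal_tendsto_simps .
  have ls: "((F \<circ> real_of_ereal) \<longlongrightarrow> - E2) (at_left (ereal s))"
    using Fs unfolding ereal_tendsto_simps .
  have "ereal 0 < ereal s" using s by simp
  note FTC = interval_integral_FTC_nonneg[OF this _ _ nonneg l0 ls]
  have "set_integrable lborel (einterval (ereal 0) (ereal s)) f"
    and "(LBINT r=ereal 0..ereal s. f r) = - E2 - (- (E1 * 1 + E2 * 1))"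
    by (rule FTC; use dF cont in simp)+
  then show ?I ?E
    using s by (simp_all add: interval_lebesgue_integral_def f_def[abs_def] E1_def)
qed

section \<open>Jacobi's theta identity\<close>

lemma gaussian_cos_integral:
  "integrable lborel (\<lambda>x. std_normal_density x * cos (t * x))"
  "(LINT x|lborel. std_normal_density x * cos (t * x)) = exp (- t\<^sup>2 / 2)"
proof -
  interpret real_distribution std_normal_distribution by (rule real_dist_normal_dist)
  have meas: "(\<lambda>x. iexp (t * x)) \<in> borel_measurable lborel" by measurable
  have "complex_of_real (exp (- t\<^sup>2 / 2)) = char std_normal_distribution t"
    by (simp add: char_std_normal_distribution)
  also have "\<dots> = (CLINT x|lborel. std_normal_density x *\<^sub>R iexp (t * x))"
    unfolding char_def by (rule integral_density) (use meas in auto)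
  finally have 1: "complex_of_real (exp (- t\<^sup>2 / 2)) = (CLINT x|lborel. std_normal_density x *\<^sub>R iexp (t * x))" .
  have int: "complex_integrable lborel (\<lambda>x. std_normal_density x *\<^sub>R iexp (t * x))"
  proof (rule Bochner_Integration.integrable_bound)
    show "integrable lborel std_normal_density"
      using integrable_std_normal_moment[of 0] by simp
    show "AE x in lborel. norm (std_normal_density x *\<^sub>R iexp (t * x)) \<le> norm (std_normal_density x)"
      by simp
  qed (use meas in measurable)
  have Re: "Re (std_normal_density x *\<^sub>R iexp (t * x)) = std_normal_density x * cos (t * x)" for x
    by (simp add: Re_exp)
  show "integrable lborel (\<lambda>x. std_normal_density x * cos (t * x))"
    using integrable_Re[OF int] unfolding Re .
  have "(LINT x|lborel. Re (std_normal_density x *\<^sub>R iexp (t * x)))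
     = Re (CLINT x|lborel. std_normal_density x *\<^sub>R iexp (t * x))"
    by (rule integral_Re[OF int])
  then show "(LINT x|lborel. std_normal_density x * cos (t * x)) = exp (- t\<^sup>2 / 2)"
    unfolding Re 1[symmetric] by simp
qed

text \<open>The dilation by 2 matches the spacing of \<open>heat (2 * real j)\<close>. At t = k pi
  with k = 2j + 1 the exponent becomes that of the j-th term of \<open>f_T1\<close>.\<close>

lemma heat_cos_integral:
  assumes s: "s > 0"
  shows "integrable lborel (\<lambda>x. heat (2 * x) s * cos (t * x))"
    "(LINT x|lborel. heat (2 * x) s * cos (t * x)) = exp (- t\<^sup>2 * s / 8) / 2"
proof -
  define c where "c = 2 / sqrt s"
  have c: "c \<noteq> 0" "c > 0" using s by (auto simp: c_def)
  have eq: "std_normal_density (0 + c * x) * cos (t / c * (0 + c * x)) = sqrt s * (heat (2 * x) s * cos (t * x))" for x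
  proof -
    have "(c * x)\<^sup>2 = 4 * x\<^sup>2 / s" using s by (simp add: c_def power_divide power_mult_distrib)
    then show ?thesis using c s
      by (simp add: std_normal_density_def heat_def real_sqrt_mult power_mult_distrib)
  qed
  have "has_bochner_integral lborel (\<lambda>x. std_normal_density (0 + c * x) * cos (t / c * (0 + c * x)))
     (exp (- (t / c)\<^sup>2 / 2) /\<^sub>R \<bar>c\<bar>)"
    by (rule lborel_has_bochner_integral_real_affine_iff[THEN iffD1, OF c(1)])
      (use gaussian_cos_integral[of "t / c"] in \<open>auto simp: has_bochner_integral_iff\<close>)
  then have "has_bochner_integral lborel (\<lambda>x. (1 / sqrt s) * (sqrt s * (heat (2 * x) s * cos (t * x))))
     ((1 / sqrt s) * (exp (- (t / c)\<^sup>2 / 2) /\<^sub>R \<bar>c\<bar>))"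
    unfolding eq by (intro has_bochner_integral_mult_right) auto
  moreover have "(1 / sqrt s) * (exp (- (t / c)\<^sup>2 / 2) /\<^sub>R \<bar>c\<bar>) = exp (- t\<^sup>2 * s / 8) / 2"
  proof -
    have "(t / c)\<^sup>2 / 2 = t\<^sup>2 * s / 8" using s by (simp add: c_def power_divide power_mult_distrib)
    then show ?thesis using s c by (simp add: c_def)
  qed
  moreover have "1 / sqrt s * (sqrt s * z) = z" for z using s by simp
  ultimately have "has_bochner_integral lborel (\<lambda>x. heat (2 * x) s * cos (t * x)) (exp (- t\<^sup>2 * s / 8) / 2)"
    by (simp only:)
  then show "integrable lborel (\<lambda>x. heat (2 * x) s * cos (t * x))"
    "(LINT x|lborel. heat (2 * x) s * cos (t * x)) = exp (- t\<^sup>2 * s / 8) / 2"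
    by (auto simp: has_bochner_integral_iff)
qed

section \<open>Cosine series on the unit interval\<close>

lemma cos_series_integral:
  fixes h :: "nat \<Rightarrow> real \<Rightarrow> real"
  assumes cont: "\<And>i. continuous_on {0..1} (h i)"
    and bound: "\<And>i x. x \<in> {0..1} \<Longrightarrow> \<bar>h i x\<bar> \<le> M i" and M: "summable M"
  shows "continuous_on {0..1} (\<lambda>x. \<Sum>i. h i x)"
    and "(\<lambda>i. integral {0..1} (\<lambda>x. h i x * cos (a * x))) sums
      integral {0..1} (\<lambda>x. (\<Sum>i. h i x) * cos (a * x))"
proof -
  have "uniform_limit {0..1} (\<lambda>n x. \<Sum>i<n. h i x) (\<lambda>x. \<Sum>i. h i x) sequentially"
    by (rule Weierstrass_m_test[OF _ M]) (use bound in auto)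
  then show "continuous_on {0..1} (\<lambda>x. \<Sum>i. h i x)"
    by (rule uniform_limit_theorem[rotated])
      (auto intro!: always_eventually continuous_on_sum cont)
  have hM: "\<bar>h i x * cos (a * x)\<bar> \<le> M i" if "x \<in> {0..1}" for i x
  proof -
    have "\<bar>h i x * cos (a * x)\<bar> \<le> \<bar>h i x\<bar> * 1"
      unfolding abs_mult by (intro mult_left_mono) auto
    then show ?thesis using bound[OF that, of i] by simp
  qed
  have sm: "summable (\<lambda>i. h i x)" if "x \<in> {0..1}" for x
    by (rule summable_comparison_test'[OF M, of 0]) (use bound that in auto)
  have contc: "continuous_on {0..1} (\<lambda>x. h i x * cos (a * x))" for i
    by (intro continuous_intros cont)
  have "uniform_limit {0..1} (\<lambda>n x. \<Sum>i<n. h i x * cos (a * x)) (\<lambda>x. \<Sum>i. h i x * cos (a * x)) sequentially"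
    by (rule Weierstrass_m_test[OF _ M]) (use hM in auto)
  then obtain I J where I: "\<And>n. ((\<lambda>x. \<Sum>i<n. h i x * cos (a * x)) has_integral I n) {0..1}"
    and J: "((\<lambda>x. \<Sum>i. h i x * cos (a * x)) has_integral J) {0..1}" and lim: "I \<longlonglongrightarrow> J"
    by (rule uniform_limit_integral) (auto intro!: continuous_on_sum contc)
  have "I n = (\<Sum>i<n. integral {0..1} (\<lambda>x. h i x * cos (a * x)))" for n
    using integral_unique[OF I[of n]]
    by (simp add: integral_sum integrable_continuous_real contc)
  moreover have "J = integral {0..1} (\<lambda>x. (\<Sum>i. h i x) * cos (a * x))"
    unfolding integral_unique[OF J, symmetric]
    by (rule integral_cong) (simp add: suminf_mult2[OF sm])
  ultimately show "(\<lambda>i. integral {0..1} (\<lambda>x. h i x * cos (a * x))) sums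
      integral {0..1} (\<lambda>x. (\<Sum>i. h i x) * cos (a * x))"
    using lim unfolding sums_def by presburger
qed

text \<open>Product-to-sum formulas extend the vanishing to all polynomials in cos(pi x). These are
  uniformly dense by Stone-Weierstrass, since cos is injective on [0, pi], so the integral of f^2 is
  0.\<close>

lemma cos_coefficients_unique:
  fixes f :: "real \<Rightarrow> real"
  assumes cont: "continuous_on {0..1} f"
    and zero: "\<And>k. integral {0..1} (\<lambda>x. f x * cos (real k * pi * x)) = 0"
    and x: "x \<in> {0..1}"
  shows "f x = 0"
proof -
  define c where "c x = cos (pi * x)" for x :: real
  have int: "(\<lambda>x. f x * poly p (c x) * cos (real k * pi * x)) integrable_on {0..1}" for p k
    unfolding c_def by (intro integrable_continuous_real continuous_intros cont)
  have mono: "integral {0..1} (\<lambda>x. f x * c x ^ m * cos (real k * pi * x)) = 0" for m k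
  proof (induction m arbitrary: k)
    case 0
    then show ?case using zero by simp
  next
    case (Suc m)
    have i: "(\<lambda>x. f x * c x ^ m * cos (real k * pi * x)) integrable_on {0..1}" for k
      using int[of "monom 1 m" k] by (simp add: poly_monom)
    show ?case
    proof (cases k)
      \<comment> \<open>The index k - 1 does not exist here, but the extra cosine factor itself is
        the frequency 1.\<close>
      case 0
      have "(\<lambda>x. f x * c x ^ Suc m * cos (real k * pi * x)) = (\<lambda>x. f x * c x ^ m * cos (real 1 * pi * x))"
        by (simp add: 0 c_def mult_ac)
      then show ?thesis using Suc.IH[of 1] by (simp only:)
    next
      case (Suc l)
      have "f x * c x ^ Suc m * cos (real k * pi * x)
          = 1/2 * (f x * c x ^ m * cos (real (k + 1) * pi * x)) + 1/2 * (f x * c x ^ m * cos (real l * pi * x))" for x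
      proof -
        have "real (k + 1) * pi * x = real k * pi * x + pi * x" "real l * pi * x = real k * pi * x - pi * x"
          using Suc by (simp_all add: algebra_simps)
        then have "cos (real (k + 1) * pi * x) + cos (real l * pi * x) = 2 * (c x * cos (real k * pi * x))"
          by (simp add: cos_add cos_diff c_def)
        moreover have "1/2 * (K * A) + 1/2 * (K * B) = K * C" if "A + B = 2 * C" for K A B C :: real
        proof -
          have "1/2 * (K * A) + 1/2 * (K * B) = 1/2 * K * (A + B)" by (simp add: distrib_left)
          then show ?thesis unfolding that by simp
        qed
        ultimately have "1/2 * (f x * c x ^ m * cos (real (k + 1) * pi * x)) + 1/2 * (f x * c x ^ m * cos (real l * pi * x))
          = f x * c x ^ m * (c x * cos (real k * pi * x))" by blast
        moreover have "f x * c x ^ Suc m * cos (real k * pi * x) = f x * c x ^ m * (c x * cos (real k * pi * x))"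
          by simp
        ultimately show ?thesis by presburger
      qed
      then show ?thesis
        using Suc.IH[of "k + 1"] Suc.IH[of l] i[of "k + 1"] i[of l]
        by (simp add: integral_add integral_mult_right)
    qed
  qed
  have polyz: "integral {0..1} (\<lambda>x. f x * poly p (c x)) = 0" for p
  proof -
    have "integral {0..1} (\<lambda>x. f x * poly p (c x))
        = integral {0..1} (\<lambda>x. \<Sum>i\<le>degree p. coeff p i * (f x * c x ^ i * cos (real 0 * pi * x)))"
      unfolding poly_altdef sum_distrib_left
      by (intro arg_cong[where f = "integral _"] ext sum.cong refl) simp
    also have "\<dots> = (\<Sum>i\<le>degree p. coeff p i * integral {0..1} (\<lambda>x. f x * c x ^ i * cos (real 0 * pi * x)))"
    proof -
      have "(\<lambda>x. f x * c x ^ i * cos (real 0 * pi * x)) integrable_on {0..1}" for i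
        using int[of "monom 1 i" 0] by (simp only: poly_monom mult_1_left)
      then show ?thesis
        by (subst integral_sum) (auto simp only: integral_mult_right finite_atMost
          intro!: integrable_on_mult_right)
    qed
    also have "\<dots> = 0" unfolding mono by simp
    finally show ?thesis .
  qed
  define B where "B = integral {0..1} (\<lambda>x. \<bar>f x\<bar>)"
  have B: "B \<ge> 0" unfolding B_def by (rule integral_nonneg) (auto intro!: integrable_continuous_real continuous_intros cont)
  have "integral {0..1} (\<lambda>x. f x * f x) \<le> e" if e: "e > 0" for e
  proof -
    \<comment> \<open>B + 1 instead of B keeps the quotient defined when the integral of |f| is
      0.\<close>
    define d where "d = e / (B + 1)"
    have d: "d > 0" using e B by (simp add: d_def)
    define P where "P g \<longleftrightarrow> (\<exists>p. g = (\<lambda>x. poly p (c x)))" for g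
    have "\<exists>g. P g \<and> (\<forall>x\<in>{0..1}. \<bar>f x - g x\<bar> < d)"
    proof (rule Stone_Weierstrass_HOL)
      show "P (\<lambda>x. k)" for k unfolding P_def by (rule exI[of _ "[:k:]"]) simp
      show "P (\<lambda>x. g x + h x)" if gh: "P g \<and> P h" for g h
      proof -
        from gh obtain p q where "g = (\<lambda>x. poly p (c x))" "h = (\<lambda>x. poly q (c x))"
          unfolding P_def by blast
        then show ?thesis unfolding P_def by (intro exI[of _ "p + q"]) simp
      qed
      show "P (\<lambda>x. g x * h x)" if gh: "P g \<and> P h" for g h
      proof -
        from gh obtain p q where "g = (\<lambda>x. poly p (c x))" "h = (\<lambda>x. poly q (c x))"
          unfolding P_def by blast
        then show ?thesis unfolding P_def by (intro exI[of _ "p * q"]) simp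
      qed
      show "continuous_on {0..1} g" if g: "P g" for g
      proof -
        from g obtain p where "g = (\<lambda>x. poly p (c x))" unfolding P_def by blast
        then show ?thesis unfolding c_def by (simp only:) (intro continuous_intros)
      qed
      show "\<exists>g. P g \<and> g x \<noteq> g y" if xy: "x \<in> {0..1} \<and> y \<in> {0..1} \<and> x \<noteq> y" for x y
      proof -
        have "pi * x = pi * y" if "c x = c y"
        proof (rule cos_inj_pi)
          show "cos (pi * x) = cos (pi * y)" using that by (simp add: c_def)
        qed (use xy in \<open>auto simp: mult_le_cancel_left1\<close>)
        then have "c x \<noteq> c y" using xy by auto
        moreover have "P c" unfolding P_def by (rule exI[of _ "[:0, 1:]"]) auto
        ultimately show ?thesis by blast
      qed
    qed (use cont d in auto)
    then obtain p where p: "\<And>x. x \<in> {0..1} \<Longrightarrow> \<bar>f x - poly p (c x)\<bar> < d"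
      unfolding P_def by blast
    have i1: "(\<lambda>x. f x * f x) integrable_on {0..1}" "(\<lambda>x. f x * poly p (c x)) integrable_on {0..1}"
      "(\<lambda>x. d * \<bar>f x\<bar>) integrable_on {0..1}"
      unfolding c_def by (intro integrable_continuous_real continuous_intros cont)+
    have "integral {0..1} (\<lambda>x. f x * f x) = integral {0..1} (\<lambda>x. f x * f x - f x * poly p (c x))"
      using i1 polyz by (simp add: integral_diff)
    also have "\<dots> \<le> integral {0..1} (\<lambda>x. d * \<bar>f x\<bar>)"
    proof (rule integral_le)
      fix x :: real assume x: "x \<in> {0..1}"
      have "f x * f x - f x * poly p (c x) = f x * (f x - poly p (c x))" by (simp add: algebra_simps)
      also have "\<dots> \<le> \<bar>f x\<bar> * \<bar>f x - poly p (c x)\<bar>" by (metis abs_ge_self abs_mult)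
      also have "\<dots> \<le> \<bar>f x\<bar> * d" using p[OF x] by (intro mult_left_mono) auto
      finally show "f x * f x - f x * poly p (c x) \<le> d * \<bar>f x\<bar>" by (simp add: mult.commute)
    qed (intro i1 integrable_diff)+
    also have "\<dots> = d * B" by (simp add: B_def)
    also have "\<dots> \<le> d * (B + 1)" using d by simp
    also have "\<dots> = e" using B by (simp add: d_def)
    finally show ?thesis .
  qed
  then have "integral {0..1} (\<lambda>x. f x * f x) \<le> 0" by (rule field_le_epsilon[where y = 0, simplified])
  moreover have "integral {0..1} (\<lambda>x. f x * f x) \<ge> 0"
    by (rule integral_nonneg) (auto intro!: integrable_continuous_real continuous_intros cont)
  ultimately have "integral {0..1} (\<lambda>x. f x * f x) = 0" by simp
  moreover have "continuous_on {0..1} (\<lambda>x. f x * f x)" by (intro continuous_intros cont)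
  ultimately have "\<forall>x\<in>{0..1}. f x * f x = 0"
    using integral_eq_0_iff[of 0 1 "\<lambda>x. f x * f x"] by simp
  then show ?thesis using x by simp
qed

lemma integral_cos_product:
  fixes i k :: nat
  shows "integral {0..1} (\<lambda>x. cos (real i * pi * x) * cos (real k * pi * x))
    = (if i = k then if i = 0 then 1 else 1/2 else 0)"
proof -
  have cosint: "((\<lambda>x. cos (of_int n * pi * x)) has_integral (if n = 0 then 1 else 0)) {0..1}" for n :: int
  proof (cases "n = 0")
    case True
    then show ?thesis using has_integral_const_real[of "1::real" 0 1] by simp
  next
    case False
    define F where "F x = sin (of_int n * pi * x) / (of_int n * pi)" for x
    have "(F has_real_derivative cos (of_int n * pi * x)) (at x)" for x
      unfolding F_def using False by (auto intro!: derivative_eq_intros)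
    then have "((\<lambda>x. cos (of_int n * pi * x)) has_integral F 1 - F 0) {0..1}"
      by (intro fundamental_theorem_of_calculus)
        (auto simp: has_real_derivative_iff_has_vector_derivative[symmetric]
          intro: has_field_derivative_at_within)
    moreover have "F 1 - F 0 = 0"
      using sin_npi_int[of n] by (simp add: F_def mult.commute)
    ultimately show ?thesis using False by simp
  qed
  \<comment> \<open>Integer frequencies, because i - k may be negative.\<close>
  define d e where "d = int i - int k" and "e = int i + int k"
  have "cos (real i * pi * x) * cos (real k * pi * x)
     = 1/2 * cos (of_int d * pi * x) + 1/2 * cos (of_int e * pi * x)" for x
  proof -
    have "of_int d * pi * x = real i * pi * x - real k * pi * x"
      "of_int e * pi * x = real i * pi * x + real k * pi * x"
      by (simp_all add: d_def e_def algebra_simps)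
    then show ?thesis by (simp add: cos_times_cos add_divide_distrib)
  qed
  moreover have "((\<lambda>x. 1/2 * cos (of_int d * pi * x) + 1/2 * cos (of_int e * pi * x)) has_integral
      1/2 * (if d = 0 then 1 else 0) + 1/2 * (if e = 0 then 1 else 0)) {0..1}"
    by (intro has_integral_add has_integral_mult_right cosint)
  ultimately have "integral {0..1} (\<lambda>x. cos (real i * pi * x) * cos (real k * pi * x))
     = 1/2 * (if d = 0 then 1 else 0) + 1/2 * (if e = 0 then 1 else 0)"
    by (simp add: integral_unique)
  also have "\<dots> = (if i = k then if i = 0 then 1 else 1/2 else 0)"
    by (auto simp: d_def e_def)
  finally show ?thesis .
qed

lemma summable_gaussian:
  fixes c :: real
  assumes "c > 0"
  shows "summable (\<lambda>i. exp (- (c * (real i)\<^sup>2)))"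
proof (rule summable_comparison_test')
  show "summable (\<lambda>i. exp (- c) ^ i)" using assms by (intro summable_geometric) simp
  fix i :: nat
  have "real i \<le> (real i)\<^sup>2" by (cases i) (auto simp: power2_eq_square)
  then show "norm (exp (- (c * (real i)\<^sup>2))) \<le> exp (- c) ^ i"
    using assms by (simp add: exp_of_nat_mult[symmetric])
qed

text \<open>\<open>u i\<close> folds the Gaussian on \<open>{i..i+1}\<close> back to \<open>{0..1}\<close>, so the sum of all \<open>u i\<close> is the even
  2-periodisation. Its cosine series is that of the \<open>v i\<close>; comparing the values at 0 minus those at 1
  keeps only the odd frequencies, which are those of \<open>f_T1\<close>.\<close>

lemma f_T1_theta:
  assumes s: "s > 0"
  shows "(\<lambda>j. (if j = 0 then 1 else 2 * (-1) ^ j) * heat (2 * real j) s) sums f_T1 s"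
proof -
  define \<phi> where "\<phi> x = heat (2 * x) s" for x
  define u where "u i x = (if even i then \<phi> (real i + x) else \<phi> (real i + 1 - x))" for i x
  have \<phi>: "\<phi> x = exp (- (2 / s * x\<^sup>2)) / sqrt (2 * pi * s)" for x
    by (simp add: \<phi>_def heat_def power_mult_distrib)
  have cont\<phi>: "continuous_on A \<phi>" for A
    unfolding \<phi>[abs_def] using s by (intro continuous_intros) auto
  have mono: "\<bar>\<phi> y\<bar> \<le> \<phi> x" if "0 \<le> x" "x \<le> y" for x y
  proof -
    have "2 / s * x\<^sup>2 \<le> 2 / s * y\<^sup>2"
      using s power_mono[OF that(2,1), of 2] by (intro mult_left_mono) auto
    then have "exp (- (2 / s * y\<^sup>2)) / sqrt (2 * pi * s) \<le> exp (- (2 / s * x\<^sup>2)) / sqrt (2 * pi * s)"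
      using s by (intro divide_right_mono) auto
    moreover have "\<bar>\<phi> y\<bar> = \<phi> y" unfolding \<phi> using s by (intro abs_of_nonneg) auto
    ultimately show ?thesis by (simp only: \<phi>)
  qed
  have sum\<phi>: "summable (\<lambda>i. \<phi> (real i))"
    unfolding \<phi> by (intro summable_divide summable_gaussian) (use s in auto)
  have contu: "continuous_on {0..1} (u i)" for i
    unfolding u_def by (cases "even i")
      (auto intro!: continuous_intros continuous_on_compose2[OF cont\<phi>[of UNIV]])
  have boundu: "\<bar>u i x\<bar> \<le> \<phi> (real i)" if "x \<in> {0..1}" for i x
    unfolding u_def using that by (auto intro!: mono)
  note U = cos_series_integral[OF contu boundu sum\<phi>]
  have contU: "continuous_on {0..1} (\<lambda>x. \<Sum>i. u i x)" by (rule U(1))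
  define a where "a k = exp (- (pi\<^sup>2 * s / 8 * (real k)\<^sup>2))" for k :: nat
  \<comment> \<open>Since cos(k pi x) is even and 2-periodic, unfolding turns each piece into the
    integral over {i..i+1}. The pieces telescope to the integral over the half-line, half of a k / 2
    by evenness.\<close>
  have coefu: "integral {0..1} (\<lambda>x. (\<Sum>i. u i x) * cos (real k * pi * x)) = a k / 4" for k
  proof -
    have c: "continuous_on UNIV (\<lambda>x. \<phi> x * cos (real k * pi * x))"
      by (intro continuous_intros cont\<phi>)
    have i: "integrable lborel (\<lambda>x. \<phi> x * cos (real k * pi * x))"
      unfolding \<phi>_def by (rule heat_cos_integral(1)[OF s])
    have l: "(LINT x|lborel. \<phi> x * cos (real k * pi * x)) = a k / 2"
      unfolding \<phi>_def heat_cos_integral(2)[OF s] a_def by (simp add: power_mult_distrib mult_ac)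
    obtain \<Psi> where der: "\<And>x. (\<Psi> has_real_derivative \<phi> x * cos (real k * pi * x)) (at x)"
      and top: "(\<Psi> \<longlongrightarrow> a k / 2) at_top" and bot: "(\<Psi> \<longlongrightarrow> 0) at_bot"
      by (rule continuous_integrable_antiderivative[OF c i, unfolded l]) blast
    have "\<Psi> 0 = a k / 2 / 2"
      by (rule even_antiderivative_at_0[OF der top bot]) (simp add: \<phi>)
    moreover have "(\<lambda>i. \<Psi> (real (Suc i)) - \<Psi> (real i)) sums (a k / 2 - \<Psi> (real 0))"
      by (rule telescope_sums) (rule filterlim_compose[OF top filterlim_real_sequentially])
    moreover have "integral {0..1} (\<lambda>x. u i x * cos (real k * pi * x)) = \<Psi> (real (Suc i)) - \<Psi> (real i)" for i
    proof (cases "even i")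
      case True
      have "cos (real k * pi * (real i + x)) = cos (real k * pi * x)" for x
      proof -
        obtain j where j: "i = 2 * j" using True by blast
        have "real k * pi * (real i + x) = real k * pi * x + 2 * pi * of_int (int (k * j))"
          by (simp add: j algebra_simps)
        then show ?thesis by (simp only: cos_add cos_int_2pin sin_int_2pin mult_1_right mult_zero_right diff_zero)
      qed
      then have u: "u i x * cos (real k * pi * x) = \<phi> (real i + x) * cos (real k * pi * (real i + x)) * 1" for x
        using True by (simp add: u_def)
      have "((\<lambda>x. \<Psi> (real i + x)) has_real_derivative u i x * cos (real k * pi * x)) (at x)" for x
        unfolding u by (rule DERIV_chain2[OF der]) (auto intro!: derivative_eq_intros)
      then have "((\<lambda>x. u i x * cos (real k * pi * x)) has_integral (\<Psi> (real i + 1) - \<Psi> (real i + 0))) {0..1}"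
        by (intro fundamental_theorem_of_calculus)
        (auto simp: has_real_derivative_iff_has_vector_derivative[symmetric]
          intro: has_field_derivative_at_within)
      then show ?thesis by (simp add: integral_unique add.commute)
    next
      case False
      have "cos (real k * pi * (real i + 1 - x)) = cos (real k * pi * x)" for x
      proof -
        obtain j where j: "i = 2 * j + 1" using False oddE by blast
        have "real k * pi * (real i + 1 - x) = 2 * pi * of_int (int (k * (j + 1))) - real k * pi * x"
          by (simp add: j algebra_simps)
        then show ?thesis by (simp only: cos_diff cos_int_2pin sin_int_2pin mult_1_left mult_zero_left add_0_right)
      qed
      then have u: "u i x * cos (real k * pi * x)
          = - (\<phi> (real i + 1 - x) * cos (real k * pi * (real i + 1 - x)) * (-1))" for x
        using False by (simp add: u_def)
      have "((\<lambda>x. - \<Psi> (real i + 1 - x)) has_real_derivative u i x * cos (real k * pi * x)) (at x)" for x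
        unfolding u by (rule DERIV_minus, rule DERIV_chain2[OF der]) (auto intro!: derivative_eq_intros)
      then have "((\<lambda>x. u i x * cos (real k * pi * x)) has_integral (- \<Psi> (real i + 1 - 1) - - \<Psi> (real i + 1 - 0))) {0..1}"
        by (intro fundamental_theorem_of_calculus)
        (auto simp: has_real_derivative_iff_has_vector_derivative[symmetric]
          intro: has_field_derivative_at_within)
      then show ?thesis by (simp add: integral_unique add.commute)
    qed
    ultimately have "(\<lambda>i. integral {0..1} (\<lambda>x. u i x * cos (real k * pi * x))) sums (a k / 2 - a k / 2 / 2)"
      by (simp only: of_nat_0)
    then have "(\<lambda>i. integral {0..1} (\<lambda>x. u i x * cos (real k * pi * x))) sums (a k / 4)"
      by simp
    with U(2)[of "real k * pi"] show ?thesis by (rule sums_unique2)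
  qed
  \<comment> \<open>Dividing a i / 4 by the squared norm of the cosine, which is 1 for i = 0 and 1/2
    otherwise, gives these coefficients; recall a 0 = 1.\<close>
  define v where "v i x = (if i = 0 then 1/4 else a i / 2) * cos (real i * pi * x)" for i x
  have suma: "summable a"
    unfolding a_def by (rule summable_gaussian) (use s in auto)
  have a: "a i > 0" "a 0 = 1" for i by (simp_all add: a_def)
  have contv: "continuous_on {0..1} (v i)" for i
    unfolding v_def by (intro continuous_intros)
  have boundv: "\<bar>v i x\<bar> \<le> a i" for i x
  proof -
    have "\<bar>v i x\<bar> \<le> (if i = 0 then 1/4 else a i / 2) * 1"
      unfolding v_def abs_mult using a(1)[of i] by (intro mult_mono) auto
    then show ?thesis using a(1)[of i] a(2) by (auto split: if_splits)
  qed
  note V = cos_series_integral[OF contv boundv suma]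
  have contV: "continuous_on {0..1} (\<lambda>x. \<Sum>i. v i x)" by (rule V(1))
  have coefv: "integral {0..1} (\<lambda>x. (\<Sum>i. v i x) * cos (real k * pi * x)) = a k / 4" for k
  proof -
    have "integral {0..1} (\<lambda>x. v i x * cos (real k * pi * x)) = (if i = k then a k / 4 else 0)" for i
      unfolding v_def mult.assoc integral_mult_right integral_cos_product[unfolded mult.assoc]
      using a by auto
    then have "(\<lambda>i. integral {0..1} (\<lambda>x. v i x * cos (real k * pi * x))) sums (a k / 4)"
      using sums_single[of k "\<lambda>_. a k / 4"] by simp
    with V(2)[of "real k * pi"] show ?thesis by (rule sums_unique2)
  qed
  have eq: "(\<Sum>i. u i x) = (\<Sum>i. v i x)" if "x \<in> {0..1}" for x
  proof -
    have "(\<Sum>i. u i x) - (\<Sum>i. v i x) = 0"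
    proof (rule cos_coefficients_unique[OF _ _ that])
      show "continuous_on {0..1} (\<lambda>x. (\<Sum>i. u i x) - (\<Sum>i. v i x))"
        by (intro continuous_intros contU contV)
      have i: "(\<lambda>x. (\<Sum>i. u i x) * cos (real k * pi * x)) integrable_on {0..1}"
          "(\<lambda>x. (\<Sum>i. v i x) * cos (real k * pi * x)) integrable_on {0..1}" for k
        by (intro integrable_continuous_real continuous_intros contU contV)+
      show "integral {0..1} (\<lambda>x. ((\<Sum>i. u i x) - (\<Sum>i. v i x)) * cos (real k * pi * x)) = 0" for k
        unfolding left_diff_distrib integral_diff[OF i] coefu coefv by simp
    qed
    then show ?thesis by simp
  qed
  have smu: "summable (\<lambda>i. u i x)" if "x \<in> {0..1}" for x
    by (rule summable_comparison_test'[OF sum\<phi>, of 0]) (use boundu that in auto)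
  have smv: "summable (\<lambda>i. v i x)" for x
    by (rule summable_comparison_test'[OF suma, of 0]) (use boundv in auto)
  define A where "A = (\<Sum>i. (-1) ^ i * \<phi> (real i))"
  have "summable (\<lambda>i. (-1) ^ i * \<phi> (real i))"
    by (rule summable_comparison_test'[OF sum\<phi>, of 0]) (use s in \<open>simp add: abs_mult \<phi>\<close>)
  then have A: "(\<lambda>i. (-1) ^ i * \<phi> (real i)) sums A" unfolding A_def by (rule summable_sums)
  then have A1: "(\<lambda>i. (-1) ^ Suc i * \<phi> (real (Suc i))) sums (A - \<phi> 0)"
    by (subst sums_Suc_iff) simp
  have "(\<lambda>i. u i 0 - u i 1) sums ((\<Sum>i. u i 0) - (\<Sum>i. u i 1))"
    by (intro sums_diff summable_sums smu) auto
  \<comment> \<open>Either parity gives (-1)^i times the drop of \<phi> from i to i + 1. Hence the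
    alternating series appears twice, the second time without its term at 0.\<close>
  moreover have "(\<lambda>i. u i 0 - u i 1) = (\<lambda>i. (-1) ^ i * \<phi> (real i) + (-1) ^ Suc i * \<phi> (real (Suc i)))"
    by (auto simp: u_def fun_eq_iff add.commute)
  ultimately have 1: "(\<Sum>i. u i 0) - (\<Sum>i. u i 1) = A + (A - \<phi> 0)"
    using sums_add[OF A A1] sums_unique2 by metis
  have "(\<lambda>i. v i 0 - v i 1) sums ((\<Sum>i. v i 0) - (\<Sum>i. v i 1))"
    by (intro sums_diff summable_sums smv)
  moreover have vd: "v i 0 - v i 1 = (if odd i then a i else 0)" for i
  proof -
    have "cos (real i * pi * 1) = (-1) ^ i" by simp
    then show ?thesis unfolding v_def by auto
  qed
  ultimately have "(\<lambda>i. if odd i then a i else 0) sums ((\<Sum>i. v i 0) - (\<Sum>i. v i 1))" by simp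
  moreover have "strict_mono (\<lambda>k::nat. 2 * k + 1)" by (auto simp: strict_mono_def)
  moreover have "(if odd n then a n else 0) = 0" if "n \<notin> range (\<lambda>k. 2 * k + 1)" for n
    using that by (auto elim!: oddE)
  ultimately have "(\<lambda>k. if odd (2 * k + 1) then a (2 * k + 1) else 0) sums ((\<Sum>i. v i 0) - (\<Sum>i. v i 1))"
    by (subst sums_mono_reindex[of "\<lambda>k. 2 * k + 1" "\<lambda>n. if odd n then a n else 0"]) auto
  moreover have "(if odd (2 * k + 1) then a (2 * k + 1) else 0) = exp (- (pi\<^sup>2 / 2 * (real k + 1/2)\<^sup>2 * s))" for k
  proof -
    have "(real (2 * k + 1))\<^sup>2 = 4 * (real k + 1/2)\<^sup>2" by (simp add: power2_eq_square algebra_simps)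
    then show ?thesis by (simp add: a_def)
  qed
  ultimately have "(\<lambda>k. exp (- (pi\<^sup>2 / 2 * (real k + 1/2)\<^sup>2 * s))) sums ((\<Sum>i. v i 0) - (\<Sum>i. v i 1))"
    by (simp only:)
  then have "(\<Sum>i. v i 0) - (\<Sum>i. v i 1) = f_T1 s"
    unfolding f_T1_def by (rule sums_unique)
  with 1 eq[of 0] eq[of 1] have T: "f_T1 s = 2 * A - \<phi> 0" by simp
  have "(\<lambda>j. 2 * ((-1) ^ j * \<phi> (real j)) - (if j = 0 then \<phi> 0 else 0)) sums (2 * A - \<phi> 0)"
    by (intro sums_diff sums_mult A sums_single[of 0 "\<lambda>_. \<phi> 0", simplified])
  moreover have "(\<lambda>j. 2 * ((-1) ^ j * \<phi> (real j)) - (if j = 0 then \<phi> 0 else 0))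
     = (\<lambda>j. (if j = 0 then 1 else 2 * (-1) ^ j) * heat (2 * real j) s)"
    by (auto simp: fun_eq_iff \<phi>_def)
  ultimately show ?thesis unfolding T by simp
qed

section \<open>The convolution of the two densities\<close>

lemma summable_on_abs_real:
  fixes f :: "_ \<Rightarrow> real"
  assumes "f summable_on A"
  shows "(\<lambda>x. \<bar>f x\<bar>) summable_on A"
  using assms summable_on_iff_abs_summable_on_real[of f A] by (simp only: real_norm_def)

lemma summable_on_product_real:
  fixes f g :: "_ \<Rightarrow> real"
  assumes f: "f summable_on A" and g: "g summable_on B"
  shows "(\<lambda>(x, y). f x * g y) summable_on A \<times> B"
proof -
  have fa: "(\<lambda>x. \<bar>f x\<bar>) summable_on A" and ga: "(\<lambda>x. \<bar>g x\<bar>) summable_on B"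
    using f g by (auto intro: summable_on_abs_real)
  have "(\<lambda>xy. \<bar>f (fst xy)\<bar> * \<bar>g (snd xy)\<bar>) summable_on A \<times> B"
  proof (rule summable_on_SigmaI)
    show "((\<lambda>y. \<bar>f (fst (x, y))\<bar> * \<bar>g (snd (x, y))\<bar>) has_sum \<bar>f x\<bar> * infsum (\<lambda>y. \<bar>g y\<bar>) B) B" for x
      using ga by (auto intro!: has_sum_cmult_right)
    show "(\<lambda>x. \<bar>f x\<bar> * infsum (\<lambda>y. \<bar>g y\<bar>) B) summable_on A"
      by (intro summable_on_cmult_left fa)
  qed auto
  then show ?thesis
    by (subst summable_on_iff_abs_summable_on_real)
      (simp only: case_prod_unfold abs_mult real_norm_def)
qed

lemma has_sum_product_real:
  fixes f g :: "_ \<Rightarrow> real"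
  assumes f: "(f has_sum a) A" and g: "(g has_sum b) B"
  shows "((\<lambda>(x, y). f x * g y) has_sum a * b) (A \<times> B)"
proof (rule has_sum_SigmaI)
  show "((\<lambda>y. case (x, y) of (x, y) \<Rightarrow> f x * g y) has_sum f x * b) B" for x
    using g by (auto intro!: has_sum_cmult_right)
  show "((\<lambda>x. f x * b) has_sum a * b) A"
    using f by (rule has_sum_cmult_left)
  show "(\<lambda>(x, y). f x * g y) summable_on A \<times> B"
    using f g by (intro summable_on_product_real) (auto simp: summable_on_def)
qed

lemma sums_imp_has_sum_real:
  fixes f :: "nat \<Rightarrow> real"
  assumes "summable (\<lambda>n. \<bar>f n\<bar>)" "f sums S"
  shows "(f has_sum S) UNIV"
  using norm_summable_imp_has_sum[of f S] assms by simp

text \<open>N! <= N^N, and ln N is at most a line of arbitrarily small slope, so N! A^N costs only a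
  small multiple of N^2 and a linear term in the exponent. Completing the square bounds the rest
  uniformly. The shift L accommodates Pochhammer symbols with a real base.\<close>

lemma gaussian_beats_fact_power:
  fixes A c :: real
  assumes A: "A > 0" and c: "c > 0"
  shows "\<exists>C>0. \<forall>p::nat. fact (p + L) * A ^ p * exp (- (c * (real p)\<^sup>2)) \<le> C"
proof -
  \<comment> \<open>Half of c is lost to (p + L)^2 <= 2 p^2 + 2 L^2; half of the remaining d then
    pays for the factorial. \<open>M\<close> is the intercept from ln x <= x - 1 at x = N d /
    2.\<close>
  define d where "d = c / 2"
  define M where "M = ln (2 / d)"
  define T where "T = ln A + M"
  define K where "K = exp (c * (real L)\<^sup>2) / A ^ L"
  have d: "d > 0" using c by (simp add: d_def)
  have K: "K > 0" using A by (simp add: K_def)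
  have fact_le: "fact N \<le> exp (d / 2 * (real N)\<^sup>2 + real N * M)" for N :: nat
  proof (cases "N = 0")
    case False
    have "ln (real N * (d / 2)) \<le> real N * (d / 2)"
      using False d ln_le_minus_one[of "real N * (d / 2)"] by simp
    then have "ln (real N) \<le> real N * (d / 2) + M"
      using False d by (simp add: M_def ln_mult ln_div)
    then have "real N * ln (real N) \<le> real N * (real N * (d / 2) + M)"
      by (intro mult_left_mono) auto
    then have "real N * ln (real N) \<le> d / 2 * (real N)\<^sup>2 + real N * M"
      by (simp add: algebra_simps power2_eq_square)
    moreover have "fact N \<le> (real N) ^ N" using fact_le_power[of N] by simp
    moreover have "(real N) ^ N = exp (real N * ln (real N))"
      using False by (simp add: exp_of_nat_mult)
    ultimately show ?thesis
      using exp_le_cancel_iff[of "real N * ln (real N)" "d / 2 * (real N)\<^sup>2 + real N * M"] by linarith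
  qed simp
  have main: "fact N * A ^ N * exp (- (d * (real N)\<^sup>2)) \<le> exp (T\<^sup>2 / (2 * d))" for N :: nat
  proof -
    have AN: "A ^ N = exp (real N * ln A)" using A by (simp add: exp_of_nat_mult)
    have "fact N * A ^ N * exp (- (d * (real N)\<^sup>2))
        \<le> exp (d / 2 * (real N)\<^sup>2 + real N * M) * exp (real N * ln A) * exp (- (d * (real N)\<^sup>2))"
      unfolding AN using fact_le by (intro mult_right_mono) auto
    also have "\<dots> = exp (real N * T - d / 2 * (real N)\<^sup>2)"
      by (simp add: T_def algebra_simps flip: exp_add)
    also have "\<dots> \<le> exp (T\<^sup>2 / (2 * d))"
    proof -
      have "0 \<le> (d * real N - T)\<^sup>2 / (2 * d)" using d by simp
      also have "\<dots> = T\<^sup>2 / (2 * d) - (real N * T - d / 2 * (real N)\<^sup>2)"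
        using d by (simp add: power2_eq_square field_simps)
      finally show ?thesis by simp
    qed
    finally show ?thesis .
  qed
  have "fact (p + L) * A ^ p * exp (- (c * (real p)\<^sup>2)) \<le> K * exp (T\<^sup>2 / (2 * d))" for p :: nat
  proof -
    have "(real (p + L))\<^sup>2 \<le> 2 * (real p)\<^sup>2 + 2 * (real L)\<^sup>2"
      using zero_le_power2[of "real p - real L"] by (simp add: power2_eq_square algebra_simps)
    then have "d * (real (p + L))\<^sup>2 \<le> d * (2 * (real p)\<^sup>2 + 2 * (real L)\<^sup>2)"
      using d by (intro mult_left_mono) auto
    then have "exp (- (c * (real p)\<^sup>2)) \<le> exp (c * (real L)\<^sup>2) * exp (- (d * (real (p + L))\<^sup>2))"
      by (simp add: d_def algebra_simps flip: exp_add)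
    then have "fact (p + L) * A ^ p * exp (- (c * (real p)\<^sup>2))
       \<le> fact (p + L) * A ^ p * (exp (c * (real L)\<^sup>2) * exp (- (d * (real (p + L))\<^sup>2)))"
      using A by (intro mult_left_mono) auto
    also have "\<dots> = K * (fact (p + L) * A ^ (p + L) * exp (- (d * (real (p + L))\<^sup>2)))"
      using A by (simp add: K_def power_add)
    also have "\<dots> \<le> K * exp (T\<^sup>2 / (2 * d))"
      using K main[of "p + L"] by (intro mult_left_mono) auto
    finally show ?thesis .
  qed
  moreover have "K * exp (T\<^sup>2 / (2 * d)) > 0" using K by simp
  ultimately show ?thesis by blast
qed

lemma pochhammer_le_fact:
  assumes "0 < \<nu>" "\<nu> \<le> real (Suc L)"
  shows "pochhammer \<nu> p \<le> fact (p + L)"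
proof (induction p)
  case 0
  show ?case using fact_ge_1[of L] by simp
next
  case (Suc p)
  have "pochhammer \<nu> (Suc p) = pochhammer \<nu> p * (\<nu> + real p)" by (simp add: pochhammer_Suc)
  also have "\<dots> \<le> fact (p + L) * (real (p + L) + 1)"
    using Suc.IH assms by (intro mult_mono) (auto simp: pochhammer_nonneg)
  finally show ?case by (simp add: algebra_simps)
qed

lemma exp_shifted_gaussian_le:
  fixes \<nu> s :: real
  assumes "\<nu> > 0" "s > 0"
  shows "exp (- ((2 * real p + \<nu>)\<^sup>2 / (2 * s))) \<le> exp (- (2 / s * (real p)\<^sup>2))"
proof -
  have "(2 * real p)\<^sup>2 \<le> (2 * real p + \<nu>)\<^sup>2" using assms by (intro power_mono) auto
  then have "2 / s * (real p)\<^sup>2 \<le> (2 * real p + \<nu>)\<^sup>2 / (2 * s)"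
    using assms by (simp add: field_simps power2_eq_square)
  then show ?thesis by simp
qed

lemma summable_pochhammer_gaussian:
  fixes \<nu> s :: real
  assumes \<nu>: "\<nu> > 0" and s: "s > 0"
  shows "summable (\<lambda>p. pochhammer \<nu> p / fact p * (2 * real p + \<nu>) * exp (- ((2 * real p + \<nu>)\<^sup>2 / (2 * s))))"
proof -
  obtain L where L: "\<nu> \<le> real L" using real_arch_simple by blast
  \<comment> \<open>The step from L to \<open>Suc L\<close> absorbs the linear factor 2p + \<nu>,
    and the surplus 2^p leaves a geometric majorant of ratio 1/2.\<close>
  obtain C where C: "C > 0" "\<And>p::nat. fact (p + Suc L) * 2 ^ p * exp (- (2 / s * (real p)\<^sup>2)) \<le> C"
    using gaussian_beats_fact_power[of 2 "2 / s" "Suc L"] s by auto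
  have "summable (\<lambda>p. 2 * C * (1/2::real) ^ p)" by (intro summable_mult summable_geometric) simp
  then show ?thesis
  proof (rule summable_comparison_test'[where N = 0])
    fix p :: nat
    have P: "pochhammer \<nu> p \<le> fact (p + L)" using \<nu> L by (intro pochhammer_le_fact) auto
    have nn: "pochhammer \<nu> p \<ge> 0" using \<nu> by (intro pochhammer_nonneg)
    have "pochhammer \<nu> p / fact p \<le> fact (p + L)"
      using P nn fact_ge_1[of p] divide_left_mono[of 1 "fact p" "pochhammer \<nu> p"] by simp
    then have "pochhammer \<nu> p / fact p * (2 * real p + \<nu>) \<le> fact (p + L) * (2 * (real (p + L) + 1))"
      using \<nu> L by (intro mult_mono) auto
    also have "\<dots> = 2 * fact (p + Suc L)" by (simp add: algebra_simps)
    finally have "pochhammer \<nu> p / fact p * (2 * real p + \<nu>) * exp (- ((2 * real p + \<nu>)\<^sup>2 / (2 * s)))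
       \<le> 2 * fact (p + Suc L) * exp (- (2 / s * (real p)\<^sup>2))"
      by (rule mult_mono[OF _ exp_shifted_gaussian_le[OF \<nu> s, of p]]) auto
    also have "\<dots> = 2 * (fact (p + Suc L) * 2 ^ p * exp (- (2 / s * (real p)\<^sup>2))) * (1/2) ^ p"
      by (simp add: power_one_over)
    also have "\<dots> \<le> 2 * C * (1/2) ^ p"
      using C(2)[of p] by (intro mult_right_mono mult_left_mono) auto
    finally show "norm (pochhammer \<nu> p / fact p * (2 * real p + \<nu>) * exp (- ((2 * real p + \<nu>)\<^sup>2 / (2 * s))))
       \<le> 2 * C * (1/2) ^ p"
      using \<nu> nn by simp
  qed
qed

text \<open>Coefficient of \<open>exp (- (2 * p + \<nu>) * u)\<close> in the expansion of \<open>cosh u powr (- \<nu>)\<close>.\<close>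

definition cosh_coeff :: "real \<Rightarrow> nat \<Rightarrow> real" where
  "cosh_coeff \<nu> p = 2 powr \<nu> * (-1) ^ p * pochhammer \<nu> p / fact p"

text \<open>Gamma(p + \<nu>)/Gamma \<nu> = (\<nu>)_p turns the defining series into the expansion of
  cosh^(-\<nu>), each exponential replaced by the hitting density that it transforms.\<close>

lemma f_C_has_sum:
  assumes \<nu>: "\<nu> > 0" and r: "r > 0"
  shows "((\<lambda>p. cosh_coeff \<nu> p * hitting (2 * real p + \<nu>) r) has_sum f_C \<nu> r) UNIV"
proof -
  define b where "b p = (-1) ^ p * (Gamma (real p + \<nu>) / fact p)
              * ((2 * real p + \<nu>) / sqrt (2 * pi * r ^ 3))
              * exp (- ((2 * real p + \<nu>)\<^sup>2 / (2 * r)))" for p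
  have \<Gamma>: "Gamma \<nu> > 0" using \<nu> by simp
  have g: "Gamma (real p + \<nu>) = Gamma \<nu> * pochhammer \<nu> p" for p
    using \<nu> by (simp add: pochhammer_Gamma nonpos_Ints_def Gamma_eq_zero_iff add.commute)
  have eq: "cosh_coeff \<nu> p * hitting (2 * real p + \<nu>) r = 2 powr \<nu> / Gamma \<nu> * b p" for p
    unfolding cosh_coeff_def hitting_def b_def g using \<Gamma> by (simp add: less_imp_neq[symmetric])
  have "summable (\<lambda>p. 2 powr \<nu> / sqrt (2 * pi * r ^ 3) * (pochhammer \<nu> p / fact p * (2 * real p + \<nu>) * exp (- ((2 * real p + \<nu>)\<^sup>2 / (2 * r)))))"
    by (intro summable_mult summable_pochhammer_gaussian \<nu> r)
  also have "(\<lambda>p. 2 powr \<nu> / sqrt (2 * pi * r ^ 3) * (pochhammer \<nu> p / fact p * (2 * real p + \<nu>) * exp (- ((2 * real p + \<nu>)\<^sup>2 / (2 * r)))))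
     = (\<lambda>p. \<bar>cosh_coeff \<nu> p * hitting (2 * real p + \<nu>) r\<bar>)"
    using \<nu> r by (simp add: cosh_coeff_def hitting_def abs_mult pochhammer_nonneg)
      (simp only: mult_ac)
  finally have abs: "summable (\<lambda>p. \<bar>cosh_coeff \<nu> p * hitting (2 * real p + \<nu>) r\<bar>)" .
  then have sm: "summable (\<lambda>p. cosh_coeff \<nu> p * hitting (2 * real p + \<nu>) r)"
    by (rule summable_rabs_cancel)
  have "summable b"
    using sm \<Gamma> \<nu> unfolding eq by (subst (asm) summable_cmult_iff) auto
  then have "(\<Sum>p. cosh_coeff \<nu> p * hitting (2 * real p + \<nu>) r) = f_C \<nu> r"
    unfolding eq f_C_def b_def by (rule suminf_mult)
  with sums_imp_has_sum_real[OF abs summable_sums[OF sm]] show ?thesis by simp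
qed

text \<open>The left side is the Cauchy product for tanh and cosh^(-\<nu>), the right side is the
  derivative of cosh^(-\<nu>) divided by -\<nu>.\<close>

lemma cosh_coeff_cauchy:
  assumes \<nu>: "\<nu> > 0"
  shows "(\<Sum>p\<le>m. (if p = m then 1 else 2 * (-1) ^ (m - p)) * cosh_coeff \<nu> p)
    = cosh_coeff \<nu> m * (\<nu> + 2 * real m) / \<nu>"
proof -
  define w where "w p = pochhammer \<nu> p / fact p" for p
  \<comment> \<open>Partial sums of the Taylor coefficients of (1 - x)^(-\<nu>) are coefficients for
    the exponent \<nu> + 1. The alternating signs of the two factors combine to (-1)^m, which leaves
    exactly such a partial sum.\<close>
  have sum: "(\<Sum>p<m. w p) = real m * w m / \<nu>"
  proof (induction m)
    case (Suc m)
    have "(\<Sum>p<Suc m. w p) = w m * (\<nu> + real m) / \<nu>"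
      using Suc.IH \<nu> by (simp add: add_divide_distrib algebra_simps)
    also have "w m * (\<nu> + real m) = real (Suc m) * w (Suc m)"
      by (simp add: w_def pochhammer_Suc del: of_nat_Suc)
    finally show ?case .
  qed simp
  have c: "cosh_coeff \<nu> p = 2 powr \<nu> * (-1) ^ p * w p" for p by (simp add: cosh_coeff_def w_def)
  have "(\<Sum>p\<le>m. (if p = m then 1 else 2 * (-1) ^ (m - p)) * cosh_coeff \<nu> p)
     = cosh_coeff \<nu> m + (\<Sum>p<m. (if p = m then 1 else 2 * (-1) ^ (m - p)) * cosh_coeff \<nu> p)"
    by (simp add: lessThan_Suc_atMost[symmetric])
  also have "(\<Sum>p<m. (if p = m then 1 else 2 * (-1) ^ (m - p)) * cosh_coeff \<nu> p)
     = (\<Sum>p<m. 2 * 2 powr \<nu> * (-1) ^ m * w p)"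
  proof (intro sum.cong refl)
    fix p assume "p \<in> {..<m}"
    then have "p < m" by simp
    then have "(-1::real) ^ (m - p) * (-1) ^ p = (-1) ^ m" by (simp flip: power_add)
    then have "(-1) ^ (m - p) * ((-1) ^ p * z) = (-1) ^ m * z" for z :: real
      by (simp flip: mult.assoc)
    then show "(if p = m then 1 else 2 * (-1) ^ (m - p)) * cosh_coeff \<nu> p = 2 * 2 powr \<nu> * (-1) ^ m * w p"
      using \<open>p < m\<close> by (simp add: c mult.left_commute[of _ "2 powr \<nu>"])
  qed
  also have "\<dots> = 2 * cosh_coeff \<nu> m * real m / \<nu>"
    unfolding sum_distrib_left[symmetric] sum c by simp
  finally show ?thesis using \<nu> by (simp add: add_divide_distrib algebra_simps)
qed

text \<open>Coefficient of \<open>exp (- 2 * j * u)\<close> in the expansion of \<open>tanh u\<close>.\<close>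

definition theta_coeff :: "nat \<Rightarrow> real" where
  "theta_coeff j = (if j = 0 then 1 else 2 * (-1) ^ j)"

lemma f_T1_has_sum:
  assumes u: "u > 0"
  shows "((\<lambda>j. theta_coeff j * heat (2 * real j) u) has_sum f_T1 u) UNIV"
proof (rule sums_imp_has_sum_real)
  show "(\<lambda>j. theta_coeff j * heat (2 * real j) u) sums f_T1 u"
    using f_T1_theta[OF u] by (simp only: theta_coeff_def)
  have "summable (\<lambda>j. 2 / sqrt (2 * pi * u) * exp (- (2 / u * (real j)\<^sup>2)))"
    by (intro summable_mult summable_gaussian) (use u in auto)
  then show "summable (\<lambda>j. \<bar>theta_coeff j * heat (2 * real j) u\<bar>)"
  proof (rule summable_comparison_test'[where N = 0])
    fix j :: nat
    have "\<bar>theta_coeff j\<bar> \<le> 2" by (simp add: theta_coeff_def abs_mult)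
    then have "\<bar>theta_coeff j\<bar> * heat (2 * real j) u \<le> 2 * heat (2 * real j) u"
      using u by (intro mult_right_mono) (auto simp: heat_def)
    then show "norm \<bar>theta_coeff j * heat (2 * real j) u\<bar>
        \<le> 2 / sqrt (2 * pi * u) * exp (- (2 / u * (real j)\<^sup>2))"
      using u by (simp add: heat_def abs_mult power_mult_distrib)
  qed
qed

text \<open>Each pair (j, p) convolves to a heat kernel, and pairs with equal j + p give the same
  one. Exchanging sum and integral is justified by the sum of the integrals of absolute values,
  known exactly because the kernels are nonnegative.\<close>

lemma f_T1_star_f_C_has_sum:
  assumes \<nu>: "\<nu> > 0" and s: "s > 0"
  shows "((\<lambda>m. cosh_coeff \<nu> m * (\<nu> + 2 * real m) / \<nu> * heat (2 * real m + \<nu>) s)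
     has_sum (f_T1 \<star> f_C \<nu>) s) UNIV"
proof -
  define h where "h j p x = heat (2 * real j) (s - x) * hitting (2 * real p + \<nu>) x" for j p :: nat and x
  define H where "H j p x = indicator {0<..<s} x *\<^sub>R h j p x" for j p x
  define c where "c j p = theta_coeff j * cosh_coeff \<nu> p" for j p
  \<comment> \<open>Pairs are enumerated by \<open>prod_decode\<close> because termwise integration
    is applied to a sequence.\<close>
  define f where "f n x = (case prod_decode n of (j, p) \<Rightarrow> c j p * H j p x)" for n x
  have pos: "2 * real p + \<nu> > 0" for p using \<nu> by (simp add: add_nonneg_pos)
  have int: "integrable lborel (\<lambda>x. H j p x)"
    and val: "(LINT x|lborel. H j p x) = heat (2 * real j + (2 * real p + \<nu>)) s" for j p
    using heat_hitting_convolution[OF _ pos[of p] s, of "2 * real j"]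
    unfolding H_def h_def set_integrable_def set_lebesgue_integral_def by auto
  have hnn: "H j p x \<ge> 0" for j p x
    using pos[of p] by (auto simp: H_def h_def heat_def hitting_def split: split_indicator intro!: mult_nonneg_nonneg divide_nonneg_nonneg)
  have fint: "integrable lborel (f n)" for n
    unfolding f_def by (cases "prod_decode n") (auto intro!: integrable_mult_right int)
  have fval: "(LINT x|lborel. f n x) = (case prod_decode n of (j, p) \<Rightarrow> c j p * heat (2 * real j + (2 * real p + \<nu>)) s)" for n
    unfolding f_def by (cases "prod_decode n") (simp add: val)
  have fnorm: "(LINT x|lborel. norm (f n x)) = (case prod_decode n of (j, p) \<Rightarrow> \<bar>c j p\<bar> * heat (2 * real j + (2 * real p + \<nu>)) s)" for n
  proof (cases "prod_decode n")
    case (Pair j p)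
    have "norm (f n x) = \<bar>c j p\<bar> * H j p x" for x
      using hnn[of j p x] unfolding f_def Pair by (simp add: abs_mult)
    then show ?thesis by (simp add: Pair val)
  qed
  have prod: "((\<lambda>(j, p). c j p * h j p x) has_sum f_T1 (s - x) * f_C \<nu> x) UNIV" if "x \<in> {0<..<s}" for x
  proof -
    have "((\<lambda>(j, p). (theta_coeff j * heat (2 * real j) (s - x)) * (cosh_coeff \<nu> p * hitting (2 * real p + \<nu>) x))
        has_sum f_T1 (s - x) * f_C \<nu> x) (UNIV \<times> UNIV)"
      using that by (intro has_sum_product_real f_T1_has_sum f_C_has_sum \<nu>) auto
    then show ?thesis by (simp add: c_def h_def mult_ac)
  qed
  have fsum: "((\<lambda>n. f n x) has_sum f_T1 (s - x) * f_C \<nu> x) UNIV" if "x \<in> {0<..<s}" for x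
  proof -
    have "((\<lambda>n. (\<lambda>(j, p). c j p * h j p x) (prod_decode n)) has_sum f_T1 (s - x) * f_C \<nu> x) UNIV"
      using prod[OF that] has_sum_reindex_bij_betw[OF bij_prod_decode] by blast
    then show ?thesis using that by (simp add: f_def H_def case_prod_unfold)
  qed
  \<comment> \<open>The comparison family is the product of the two expansions evaluated at the same
    time s. Dropping the cross term of (2j + b)^2 splits the Gaussian, and b >= \<nu> turns the
    Gaussian in b into at most K times \<open>hitting b s\<close>.\<close>
  have all: "(\<lambda>(j, p). c j p * heat (2 * real j + (2 * real p + \<nu>)) s) summable_on UNIV"
  proof -
    define K where "K = sqrt (2 * pi * s ^ 3) / \<nu>"
    have "(\<lambda>(j, p). \<bar>theta_coeff j * heat (2 * real j) s\<bar> * \<bar>cosh_coeff \<nu> p * hitting (2 * real p + \<nu>) s\<bar>)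
        summable_on UNIV \<times> UNIV"
    proof (rule summable_on_product_real)
      show "(\<lambda>j. \<bar>theta_coeff j * heat (2 * real j) s\<bar>) summable_on UNIV"
        using f_T1_has_sum[OF s] by (intro summable_on_abs_real) (rule has_sum_imp_summable)
      show "(\<lambda>p. \<bar>cosh_coeff \<nu> p * hitting (2 * real p + \<nu>) s\<bar>) summable_on UNIV"
        using f_C_has_sum[OF \<nu> s] by (intro summable_on_abs_real) (rule has_sum_imp_summable)
    qed
    then have A: "(\<lambda>x. K * (case x of (j, p) \<Rightarrow> \<bar>theta_coeff j * heat (2 * real j) s\<bar> * \<bar>cosh_coeff \<nu> p * hitting (2 * real p + \<nu>) s\<bar>)) summable_on UNIV"
      unfolding UNIV_Times_UNIV by (rule summable_on_cmult_right)
    have "(\<lambda>x. norm (case x of (j, p) \<Rightarrow> c j p * heat (2 * real j + (2 * real p + \<nu>)) s)) summable_on UNIV"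
    proof (rule Infinite_Sum.abs_summable_on_comparison_test'[OF A])
      fix x :: "nat \<times> nat"
      obtain j p where x: "x = (j, p)" by (cases x)
      define b where "b = 2 * real p + \<nu>"
      have b: "b > 0" "b \<ge> \<nu>" using pos[of p] by (auto simp: b_def)
      have "(2 * real j + b)\<^sup>2 \<ge> (2 * real j)\<^sup>2 + b\<^sup>2"
        using b by (simp add: power2_sum)
      then have "(2 * real j)\<^sup>2 / (2 * s) + b\<^sup>2 / (2 * s) \<le> (2 * real j + b)\<^sup>2 / (2 * s)"
        using s unfolding add_divide_distrib[symmetric] by (intro divide_right_mono) auto
      then have "exp (- ((2 * real j + b)\<^sup>2 / (2 * s))) \<le> exp (- ((2 * real j)\<^sup>2 / (2 * s))) * exp (- (b\<^sup>2 / (2 * s)))"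
        unfolding exp_add[symmetric] exp_le_cancel_iff by linarith
      then have 1: "heat (2 * real j + b) s \<le> heat (2 * real j) s * exp (- (b\<^sup>2 / (2 * s)))"
        unfolding heat_def times_divide_eq_left using s by (intro divide_right_mono) auto
      have "\<nu> * exp (- (b\<^sup>2 / (2 * s))) \<le> b * exp (- (b\<^sup>2 / (2 * s)))" using b by simp
      then have "exp (- (b\<^sup>2 / (2 * s))) \<le> b * exp (- (b\<^sup>2 / (2 * s))) / \<nu>"
        using \<nu> by (simp add: pos_le_divide_eq mult.commute)
      also have "\<dots> = K * hitting b s" using s by (simp add: K_def hitting_def)
      finally have "heat (2 * real j) s * exp (- (b\<^sup>2 / (2 * s))) \<le> heat (2 * real j) s * (K * hitting b s)"
        using s by (intro mult_left_mono) (auto simp: heat_def)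
      with 1 have 2: "heat (2 * real j + b) s \<le> heat (2 * real j) s * (K * hitting b s)" by linarith
      have "\<bar>c j p\<bar> * heat (2 * real j + b) s \<le> \<bar>c j p\<bar> * (heat (2 * real j) s * (K * hitting b s))"
        by (rule mult_left_mono[OF 2]) simp
      moreover have "heat a s \<ge> 0" "hitting b s \<ge> 0" for a
        using s b by (simp_all add: heat_def hitting_def)
      ultimately show "norm (case x of (j, p) \<Rightarrow> c j p * heat (2 * real j + (2 * real p + \<nu>)) s)
          \<le> K * (case x of (j, p) \<Rightarrow> \<bar>theta_coeff j * heat (2 * real j) s\<bar> * \<bar>cosh_coeff \<nu> p * hitting (2 * real p + \<nu>) s\<bar>)"
        unfolding x prod.case b_def[symmetric] by (simp add: abs_mult c_def mult_ac)
    qed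
    then show ?thesis by (rule Infinite_Sum.abs_summable_summable)
  qed
  have normsum: "summable (\<lambda>n. LINT x|lborel. norm (f n x))"
  proof -
    have nn: "heat a s \<ge> 0" for a using s by (simp add: heat_def)
    have "(\<lambda>jp. \<bar>case jp of (j, p) \<Rightarrow> c j p * heat (2 * real j + (2 * real p + \<nu>)) s\<bar>) summable_on UNIV"
      using all by (rule summable_on_abs_real)
    then have "(\<lambda>n. \<bar>case prod_decode n of (j, p) \<Rightarrow> c j p * heat (2 * real j + (2 * real p + \<nu>)) s\<bar>) summable_on UNIV"
      using summable_on_reindex_bij_betw[OF bij_prod_decode, where
        f = "\<lambda>jp. \<bar>case jp of (j, p) \<Rightarrow> c j p * heat (2 * real j + (2 * real p + \<nu>)) s\<bar>"]
      by simp
    then have "summable (\<lambda>n. \<bar>case prod_decode n of (j, p) \<Rightarrow> c j p * heat (2 * real j + (2 * real p + \<nu>)) s\<bar>)"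
      by (rule summable_on_imp_summable)
    moreover have "(LINT x|lborel. norm (f n x)) = \<bar>case prod_decode n of (j, p) \<Rightarrow> c j p * heat (2 * real j + (2 * real p + \<nu>)) s\<bar>" for n
      unfolding fnorm using nn by (cases "prod_decode n") (simp add: abs_mult)
    ultimately show ?thesis by simp
  qed
  have ptnorm: "AE x in lborel. summable (\<lambda>n. norm (f n x))"
  proof (rule AE_I2)
    fix x
    show "summable (\<lambda>n. norm (f n x))"
    proof (cases "x \<in> {0<..<s}")
      case True
      have "(\<lambda>n. norm (f n x)) summable_on UNIV"
        unfolding real_norm_def by (rule summable_on_abs_real[OF has_sum_imp_summable[OF fsum[OF True]]])
      then show ?thesis by (rule summable_on_imp_summable)
    next
      case False
      then have "norm (f n x) = 0" for n by (auto simp: f_def H_def split: prod.splits)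
      then show ?thesis by simp
    qed
  qed
  have "(LINT x|lborel. (\<Sum>n. f n x)) = (f_T1 \<star> f_C \<nu>) s"
    unfolding Defs.convolution_def set_lebesgue_integral_def
  proof (rule Bochner_Integration.integral_cong[OF refl])
    fix x
    show "(\<Sum>n. f n x) = indicator {0<..<s} x *\<^sub>R (f_T1 (s - x) * f_C \<nu> x)"
    proof (cases "x \<in> {0<..<s}")
      case True
      then show ?thesis using sums_unique[OF has_sum_imp_sums[OF fsum[OF True]]] by simp
    next
      case False
      then have "f n x = 0" for n by (auto simp: f_def H_def split: prod.splits)
      then show ?thesis using False by simp
    qed
  qed
  with sums_integral[OF fint ptnorm normsum]
  have sums: "(\<lambda>n. case prod_decode n of (j, p) \<Rightarrow> c j p * heat (2 * real j + (2 * real p + \<nu>)) s) sums (f_T1 \<star> f_C \<nu>) s"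
    unfolding fval by simp
  have H: "((\<lambda>(j, p). c j p * heat (2 * real j + (2 * real p + \<nu>)) s) has_sum (f_T1 \<star> f_C \<nu>) s) UNIV"
  proof -
    \<comment> \<open>The unordered sum exists by absolute summability; its value is read off along
      the enumeration.\<close>
    obtain S where S: "((\<lambda>(j, p). c j p * heat (2 * real j + (2 * real p + \<nu>)) s) has_sum S) UNIV"
      using all by (auto simp: summable_on_def)
    then have "((\<lambda>n. case prod_decode n of (j, p) \<Rightarrow> c j p * heat (2 * real j + (2 * real p + \<nu>)) s) has_sum S) UNIV"
      using has_sum_reindex_bij_betw[OF bij_prod_decode] by blast
    from sums_unique2[OF has_sum_imp_sums[OF this] sums] S show ?thesis by simp
  qed
  \<comment> \<open>With m = j + p the heat kernel is constant on each fibre p <= m, leaving the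
    finite Cauchy sum as coefficient.\<close>
  have "((\<lambda>(m, p). c (m - p) p * heat (2 * real m + \<nu>) s) has_sum (f_T1 \<star> f_C \<nu>) s) (Sigma UNIV (\<lambda>m. {..m}))"
    by (rule has_sum_reindex_bij_witness[where i = "\<lambda>(j, p). (j + p, p)" and j = "\<lambda>(m, p). (m - p, p)",
        THEN iffD2, OF _ _ _ _ _ refl H]) (auto simp: of_nat_diff algebra_simps)
  from has_sum_SigmaD[OF this, of "\<lambda>m. \<Sum>p\<le>m. c (m - p) p * heat (2 * real m + \<nu>) s"]
  have "((\<lambda>m. \<Sum>p\<le>m. c (m - p) p * heat (2 * real m + \<nu>) s) has_sum (f_T1 \<star> f_C \<nu>) s) UNIV"
    by (auto intro!: has_sum_finiteI)
  moreover have "(\<Sum>p\<le>m. c (m - p) p * heat (2 * real m + \<nu>) s)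
      = cosh_coeff \<nu> m * (\<nu> + 2 * real m) / \<nu> * heat (2 * real m + \<nu>) s" for m
  proof -
    have "(\<Sum>p\<le>m. c (m - p) p) = (\<Sum>p\<le>m. (if p = m then 1 else 2 * (-1) ^ (m - p)) * cosh_coeff \<nu> p)"
      by (intro sum.cong refl) (auto simp: c_def theta_coeff_def)
    then show ?thesis unfolding sum_distrib_right[symmetric] cosh_coeff_cauchy[OF \<nu>] by simp
  qed
  ultimately show ?thesis by simp
qed

section \<open>The expansion\<close>

text \<open>The normalisation of the polynomials cancels against the norm, which leaves (N +
  g)(2g)_N / (g N!) times the two hypergeometric factors. The kernel has the same dependence on N
  except for N + g.\<close>

lemma jacobi_product_eq_kernel:
  fixes \<alpha> x y :: real
  assumes a: "\<alpha> > -1/2"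
  shows "inverse (ultra_sqnorm N \<alpha>) * jacobi_P N \<alpha> \<alpha> x * jacobi_P N \<alpha> \<alpha> y
    = Gamma (\<alpha> + 1) / Gamma (\<alpha> + 3/2) * (real N + \<alpha> + 1/2) * ultra_product_kernel N (\<alpha> + 1/2) x y"
proof -
  define g where "g = \<alpha> + 1/2"
  have g: "g > 0" using a by (simp add: g_def)
  define P where "P = pochhammer (\<alpha> + 1) N / fact N"
  define Q where "Q z = hyp2F1 (- real N) (real N + 2 * g) (g + 1/2) ((1 - z) / 2)" for z
  define X where "X = pochhammer (2 * g) N"
  define G where "G = Gamma (\<alpha> + 1)"
  have pos: "P > 0" "X > 0" "G > 0" "Gamma g > 0"
    using a g by (auto simp: P_def X_def G_def intro!: pochhammer_pos divide_pos_pos)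
  have al: "\<alpha> + 1 = g + 1/2" "real N + \<alpha> + \<alpha> + 1 = real N + 2 * g" "2 * \<alpha> + 1 = 2 * g"
    "real N + \<alpha> + 1/2 = real N + g" "\<alpha> + 1/2 = g" "\<alpha> + 3/2 = g + 1"
    by (auto simp: g_def)
  have J: "jacobi_P N \<alpha> \<alpha> z = P * Q z" for z
    unfolding jacobi_P_def P_def Q_def al ..
  have R: "ultra_sqnorm N \<alpha> = P\<^sup>2 * (g * fact N / ((real N + g) * X))"
    unfolding ultra_sqnorm_eq[OF a] P_def X_def al ..
  have U: "ultra_product_kernel N g x y = Gamma g * X / (fact N * G) * Q x * Q y"
    unfolding ultra_product_kernel_eq[OF g] X_def G_def Q_def al ..
  have "inverse (P\<^sup>2 * (g * fact N / ((real N + g) * X))) * (P * Q x) * (P * Q y)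
      = (real N + g) * X / (g * fact N) * Q x * Q y"
  proof -
    have "inverse (P\<^sup>2 * (g * fact N / ((real N + g) * X))) = inverse (P * P) * ((real N + g) * X / (g * fact N))"
      by (simp only: power2_eq_square divide_inverse inverse_mult_distrib inverse_inverse_eq mult_ac)
    moreover have "inverse (P * P) * r * (P * u) * (P * v) = r * u * v" for r u v
      using pos(1) by (simp add: field_simps)
    ultimately show ?thesis by simp
  qed
  also have "\<dots> = G / (g * Gamma g) * (real N + g) * (Gamma g * X / (fact N * G) * Q x * Q y)"
    using pos(3,4) by simp
  finally show ?thesis
    unfolding J R al(4,5,6) U Gamma_real_plus1[OF g] G_def .
qed

text \<open>Only the first factor can be less than 1. This gives a lower bound for Gamma(g + 1/2 +
  n) that is uniform in n.\<close>

lemma pochhammer_ge_half: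
  assumes "(a::real) \<ge> 1/2"
  shows "pochhammer a n \<ge> 1/2"
proof (induction n)
  case (Suc n)
  show ?case
  proof (cases "n = 0")
    case False
    have "1/2 * 1 \<le> pochhammer a n * (a + real n)"
      using Suc.IH assms False by (intro mult_mono) auto
    then show ?thesis by (simp add: pochhammer_Suc)
  qed (use assms in simp)
qed simp

text \<open>The \<open>m\<close>-th term of the series for the convolution, times the coefficient with index \<open>(n, k)\<close>,
  rearranged so that it depends on \<open>s\<close> only through \<open>2 * n + k + 2 * m\<close>.\<close>

definition expansion_term :: "real \<Rightarrow> real \<Rightarrow> real \<Rightarrow> real \<Rightarrow> nat \<Rightarrow> nat \<Rightarrow> nat \<Rightarrow> real" where
  "expansion_term g s x y n k m = 2 powr g * (real (2 * n + k + 2 * m) + g)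
     * heat (real (2 * n + k + 2 * m) + g) s
     * (((1 - x\<^sup>2) * (1 - y\<^sup>2)) ^ n / (fact n * Gamma (g + 1/2 + real n))
     * ((-1) ^ m * Gamma (g + real (2 * n + k + m)) / (fact m * fact k) * 2 ^ k * (x * y) ^ k))"

text \<open>At fixed N the heat factor is common. Put l = g + 2n and M = N - 2n = k + 2m: the Gamma
  factor is Gamma(l + M - m), so the sum over m is a Gegenbauer polynomial and the sum over n is the
  kernel.\<close>

lemma expansion_term_sum:
  "(\<Sum>(n, m)\<in>(SIGMA n:{n. 2 * n \<le> N}. {m. 2 * m \<le> N - 2 * n}). expansion_term g s x y n (N - 2 * n - 2 * m) m)
     = 2 powr g * (real N + g) * heat (real N + g) s * ultra_product_kernel N g x y"
proof -
  have fin: "finite {m. 2 * m \<le> M}" for M :: nat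
    by (rule finite_subset[of _ "{..M}"]) auto
  define E where "E = 2 powr g * (real N + g) * heat (real N + g) s"
  define c where "c n = ((1 - x\<^sup>2) * (1 - y\<^sup>2)) ^ n / (fact n * Gamma (g + 1/2 + real n))" for n
  have T: "(\<Sum>m | 2 * m \<le> N - 2 * n. expansion_term g s x y n (N - 2 * n - 2 * m) m)
     = E * (c n * gegenbauer_deriv 0 (N - 2 * n) (g + 2 * real n) (x * y))" if n: "2 * n \<le> N" for n
  proof -
    have "gegenbauer_deriv 0 (N - 2 * n) (g + 2 * real n) (x * y)
       = (\<Sum>m | 2 * m \<le> N - 2 * n. (-1) ^ m * Gamma (g + 2 * real n + real (N - 2 * n) - real m)
          / (fact m * fact (N - 2 * n - 2 * m - 0)) * 2 ^ (N - 2 * n - 2 * m) * (x * y) ^ (N - 2 * n - 2 * m - 0))"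
      unfolding gegenbauer_deriv_def by (rule sum.mono_neutral_cong_right) auto
    moreover have "expansion_term g s x y n (N - 2 * n - 2 * m) m = E * (c n * ((-1) ^ m * Gamma (g + 2 * real n + real (N - 2 * n) - real m)
          / (fact m * fact (N - 2 * n - 2 * m - 0)) * 2 ^ (N - 2 * n - 2 * m) * (x * y) ^ (N - 2 * n - 2 * m - 0)))"
      if m: "2 * m \<le> N - 2 * n" for m
    proof -
      obtain k where k: "N = 2 * n + 2 * m + k"
        using n m by (metis add.commute le_add_diff_inverse2 le_diff_conv2 le_iff_add add.assoc)
      have e: "N - 2 * n - 2 * m = k" "2 * n + k + 2 * m = N"
        "g + 2 * real n + real (N - 2 * n) - real m = g + real (2 * n + k + m)" using k by auto
      show ?thesis unfolding expansion_term_def e E_def c_def diff_zero ..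
    qed
    ultimately show ?thesis by (simp add: sum_distrib_left)
  qed
  have "(\<Sum>(n, m)\<in>(SIGMA n:{n. 2 * n \<le> N}. {m. 2 * m \<le> N - 2 * n}). expansion_term g s x y n (N - 2 * n - 2 * m) m)
     = (\<Sum>n | 2 * n \<le> N. \<Sum>m | 2 * m \<le> N - 2 * n. expansion_term g s x y n (N - 2 * n - 2 * m) m)"
    using fin by (subst sum.Sigma) auto
  also have "\<dots> = (\<Sum>n | 2 * n \<le> N. E * (c n * gegenbauer_deriv 0 (N - 2 * n) (g + 2 * real n) (x * y)))"
    by (intro sum.cong refl T) auto
  also have "\<dots> = E * ultra_product_kernel N g x y"
    unfolding sum_distrib_left[symmetric] ultra_product_kernel_def c_def
    by (intro arg_cong[where f = "(*) E"] sum.mono_neutral_cong_left) auto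
  finally show ?thesis unfolding E_def .
qed

text \<open>Apart from the Gaussian, every factor is controlled by a factorial and a power in N = 2n
  + k + 2m. A majorant geometric in N is a product of geometric sequences in n, k and m.\<close>

lemma expansion_term_summable:
  assumes g: "g > 0" and s: "s > 0" and x: "\<bar>x\<bar> \<le> 1" and y: "\<bar>y\<bar> \<le> 1"
  shows "(\<lambda>((n, k), m). expansion_term g s x y n k m) summable_on UNIV"
proof -
  obtain L where L: "g \<le> real L" using real_arch_simple by blast
  \<comment> \<open>Base 4 rather than 2: the terms grow at most like 2^N, and the second 2^N yields
    the ratio 1/2. \<open>Suc L\<close> absorbs N + g.\<close>
  obtain C where C: "C > 0" "\<And>p::nat. fact (p + Suc L) * 4 ^ p * exp (- (1 / (2 * s) * (real p)\<^sup>2)) \<le> C"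
    using gaussian_beats_fact_power[of 4 "1 / (2 * s)" "Suc L"] s by auto
  define K where "K = 2 powr g * 2 / sqrt (2 * pi * s) * (2 / Gamma (g + 1/2)) * Gamma g"
  have \<Gamma>: "Gamma g > 0" "Gamma (g + 1/2) > 0" using g by auto
  have K: "K > 0" using \<Gamma> s by (simp add: K_def)
  have bound: "\<bar>expansion_term g s x y n k m\<bar> \<le> K * C * ((1/4) ^ n * (1/2) ^ k * (1/4) ^ m)" for n k m
  proof -
    define N where "N = 2 * n + k + 2 * m"
    define F where "F = (fact (N + L) :: real)"
    have w: "\<bar>((1 - x\<^sup>2) * (1 - y\<^sup>2)) ^ n\<bar> \<le> 1"
    proof -
      have "x\<^sup>2 \<le> 1" "y\<^sup>2 \<le> 1" using x y by (simp_all add: abs_square_le_1)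
      then have "\<bar>(1 - x\<^sup>2) * (1 - y\<^sup>2)\<bar> \<le> 1 * 1" unfolding abs_mult by (intro mult_mono) auto
      then show ?thesis unfolding power_abs by (intro power_le_one) auto
    qed
    have z: "\<bar>(x * y) ^ k\<bar> \<le> 1"
    proof -
      have "\<bar>x * y\<bar> \<le> 1 * 1" unfolding abs_mult using x y by (intro mult_mono) auto
      then show ?thesis unfolding power_abs by (intro power_le_one) auto
    qed
    \<comment> \<open>Gamma is not monotone near its minimum, so half of the initial value serves as
      lower bound.\<close>
    have gn: "Gamma (g + 1/2 + real n) \<ge> Gamma (g + 1/2) / 2"
    proof -
      have "Gamma (g + 1/2 + real n) = Gamma (g + 1/2) * pochhammer (g + 1/2) n"
        using g \<Gamma> by (simp add: pochhammer_Gamma nonpos_Ints_def Gamma_eq_zero_iff)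
      then show ?thesis using mult_left_mono[OF pochhammer_ge_half[of "g + 1/2" n], of "Gamma (g + 1/2)"] g \<Gamma> by simp
    qed
    have f1: "\<bar>((1 - x\<^sup>2) * (1 - y\<^sup>2)) ^ n / (fact n * Gamma (g + 1/2 + real n))\<bar> \<le> 2 / Gamma (g + 1/2)"
    proof -
      have "Gamma (g + 1/2) / 2 \<le> 1 * Gamma (g + 1/2 + real n)" using gn by simp
      also have "\<dots> \<le> fact n * Gamma (g + 1/2 + real n)"
        using gn \<Gamma> by (intro mult_right_mono) auto
      finally have "Gamma (g + 1/2) / 2 \<le> fact n * Gamma (g + 1/2 + real n)" .
      then have "\<bar>((1 - x\<^sup>2) * (1 - y\<^sup>2)) ^ n\<bar> / \<bar>fact n * Gamma (g + 1/2 + real n)\<bar> \<le> 1 / (Gamma (g + 1/2) / 2)"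
        using w \<Gamma> by (intro frac_le) auto
      then show ?thesis by simp
    qed
    have f2: "\<bar>(-1) ^ m * Gamma (g + real (2 * n + k + m)) / (fact m * fact k) * 2 ^ k * (x * y) ^ k\<bar>
       \<le> Gamma g * F * 2 ^ N"
    proof -
      have "Gamma (g + real (2 * n + k + m)) = Gamma g * pochhammer g (2 * n + k + m)"
        using g \<Gamma> by (simp add: pochhammer_Gamma nonpos_Ints_def Gamma_eq_zero_iff)
      also have "\<dots> \<le> Gamma g * fact (2 * n + k + m + L)"
        using \<Gamma> g L by (intro mult_left_mono pochhammer_le_fact) auto
      also have "\<dots> \<le> Gamma g * F"
        unfolding F_def using \<Gamma> by (intro mult_left_mono fact_mono) (auto simp: N_def)
      finally have 1: "Gamma (g + real (2 * n + k + m)) \<le> Gamma g * F" .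
      have pos: "Gamma (g + real (2 * n + k + m)) > 0" using g by simp
      have "\<bar>(-1) ^ m * Gamma (g + real (2 * n + k + m)) / (fact m * fact k) * 2 ^ k * (x * y) ^ k\<bar>
         = Gamma (g + real (2 * n + k + m)) / (fact m * fact k) * 2 ^ k * \<bar>(x * y) ^ k\<bar>"
        using pos by (simp add: abs_mult)
      also have "\<dots> \<le> Gamma g * F * 2 ^ N * 1"
      proof (intro mult_mono z)
        have "1 * 1 \<le> (fact m * fact k :: real)" by (intro mult_mono) auto
        then have "Gamma (g + real (2 * n + k + m)) / (fact m * fact k) \<le> Gamma (g + real (2 * n + k + m)) / 1"
          using pos by (intro divide_left_mono) auto
        then show "Gamma (g + real (2 * n + k + m)) / (fact m * fact k) \<le> Gamma g * F" using 1 by simp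
        show "(2::real) ^ k \<le> 2 ^ N" by (intro power_increasing) (auto simp: N_def)
      qed (use \<Gamma> in \<open>auto simp: F_def\<close>)
      finally show ?thesis by simp
    qed
    have f3: "heat (real N + g) s \<le> exp (- (1 / (2 * s) * (real N)\<^sup>2)) / sqrt (2 * pi * s)"
    proof -
      have "(real N)\<^sup>2 \<le> (real N + g)\<^sup>2" using g by (intro power_mono) auto
      then have "1 / (2 * s) * (real N)\<^sup>2 \<le> (real N + g)\<^sup>2 / (2 * s)"
        using s by (simp add: divide_right_mono)
      then show ?thesis unfolding heat_def using s by (intro divide_right_mono) auto
    qed
    have hn: "heat (real N + g) s \<ge> 0" using s by (simp add: heat_def)
    have "\<bar>expansion_term g s x y n k m\<bar> = 2 powr g * (real N + g) * heat (real N + g) s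
       * (\<bar>((1 - x\<^sup>2) * (1 - y\<^sup>2)) ^ n / (fact n * Gamma (g + 1/2 + real n))\<bar>
       * \<bar>(-1) ^ m * Gamma (g + real (2 * n + k + m)) / (fact m * fact k) * 2 ^ k * (x * y) ^ k\<bar>)"
      unfolding expansion_term_def N_def[symmetric] abs_mult[of "2 powr g * (real N + g) * heat (real N + g) s"]
        abs_mult[of "((1 - x\<^sup>2) * (1 - y\<^sup>2)) ^ n / (fact n * Gamma (g + 1/2 + real n))"]
      using g hn by simp
    also have "\<dots> \<le> 2 powr g * (2 * real (N + L + 1)) * (exp (- (1 / (2 * s) * (real N)\<^sup>2)) / sqrt (2 * pi * s))
       * (2 / Gamma (g + 1/2) * (Gamma g * F * 2 ^ N))"
      using g L \<Gamma> s f1 f2 f3 hn by (intro mult_mono mult_nonneg_nonneg divide_nonneg_nonneg) auto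
    also have "\<dots> = K * (real (N + L + 1) * F * 2 ^ N * exp (- (1 / (2 * s) * (real N)\<^sup>2)))"
      by (simp add: K_def)
    also have "real (N + L + 1) * F = fact (N + Suc L)" by (simp add: F_def)
    also have "fact (N + Suc L) * 2 ^ N * exp (- (1 / (2 * s) * (real N)\<^sup>2))
        = (fact (N + Suc L) * 4 ^ N * exp (- (1 / (2 * s) * (real N)\<^sup>2))) * (1/2) ^ N"
    proof -
      have "(2::real) ^ N = 4 ^ N * (1/2) ^ N" unfolding power_mult_distrib[symmetric] by simp
      then show ?thesis by (simp only: mult_ac)
    qed
    also have "K * \<dots> \<le> K * (C * (1/2) ^ N)"
      using K C(2)[of N] by (intro mult_left_mono mult_right_mono) auto
    also have "(1/2::real) ^ N = (1/4) ^ n * (1/2) ^ k * (1/4) ^ m"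
      by (simp add: N_def power_add power_mult power_one_over)
    finally show ?thesis by (simp only: mult.assoc)
  qed
  have geo: "(\<lambda>n. q ^ n) summable_on UNIV" if "0 < q" "q < 1" for q :: real
    using that by (subst summable_on_UNIV_nonneg_real_iff) (auto intro: summable_geometric)
  have "(\<lambda>((n, k), m). (1/4) ^ n * (1/2) ^ k * (1/4) ^ m :: real) summable_on UNIV"
    using summable_on_product_real[OF summable_on_product_real[OF geo[of "1/4"] geo[of "1/2"]] geo[of "1/4"]]
    by (simp add: case_prod_unfold)
  from summable_on_cmult_right[OF this, of "K * C"]
  have A: "(\<lambda>i. K * C * (case i of ((n, k), m) \<Rightarrow> (1/4) ^ n * (1/2) ^ k * (1/4) ^ m)) summable_on UNIV"
    by (simp only: case_prod_unfold)
  have "(\<lambda>i. norm ((\<lambda>((n, k), m). expansion_term g s x y n k m) i)) summable_on UNIV"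
    by (rule Infinite_Sum.abs_summable_on_comparison_test'[OF A]) (use bound in auto)
  then show ?thesis by (rule Infinite_Sum.abs_summable_summable)
qed

text \<open>The index k is recovered from (N, n, m) as N - 2n - 2m, and the fibres over N are
  finite, so the unordered triple sum becomes an ordinary series in N.\<close>

lemma expansion_term_regroup:
  assumes "((\<lambda>((n, k), m). expansion_term g s x y n k m) has_sum S) UNIV"
  shows "(\<lambda>N. 2 powr g * (real N + g) * heat (real N + g) s * ultra_product_kernel N g x y) sums S"
proof -
  define B where "B N = (SIGMA n:{n. 2 * n \<le> N}. {m. 2 * m \<le> N - 2 * n})" for N :: nat
  have fin: "finite (B N)" for N
    by (rule finite_subset[of _ "{..N} \<times> {..N}"]) (auto simp: B_def)
  have "((\<lambda>(N, n, m). expansion_term g s x y n (N - 2 * n - 2 * m) m) has_sum S) (Sigma UNIV B)"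
    by (rule has_sum_reindex_bij_witness[where i = "\<lambda>((n, k), m). (2 * n + k + 2 * m, n, m)"
        and j = "\<lambda>(N, n, m). ((n, N - 2 * n - 2 * m), m)", THEN iffD2, OF _ _ _ _ _ refl assms])
      (auto simp: B_def)
  from has_sum_SigmaD[OF this, of "\<lambda>N. \<Sum>(n, m)\<in>B N. expansion_term g s x y n (N - 2 * n - 2 * m) m"]
  have "((\<lambda>N. \<Sum>(n, m)\<in>B N. expansion_term g s x y n (N - 2 * n - 2 * m) m) has_sum S) UNIV"
    using fin by (auto intro!: has_sum_finiteI simp: case_prod_unfold)
  then show ?thesis
    unfolding B_def expansion_term_sum by (rule has_sum_imp_sums)
qed

text \<open>Besides Gamma(\<nu> + 1)(\<nu>)_m / \<nu> = Gamma(\<nu> + m), the matching uses 2^\<nu>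
  = 2^g 4^n 2^k: the 4^n cancels the 1/4 in the bracket and the 2^k belongs to the Gegenbauer
  coefficient.\<close>

lemma expansion_term_has_sum_convolution:
  fixes \<alpha> s x y :: real and n k :: nat
  assumes a: "\<alpha> > -1/2" and s: "s > 0"
  shows "((\<lambda>m. expansion_term (\<alpha> + 1/2) s x y n k m) has_sum
     (Gamma (nu n k \<alpha> + 1) * (x * y) ^ k / (fact k * fact n * Gamma (\<alpha> + real n + 1))
        * ((1 - x\<^sup>2) * (1 - y\<^sup>2) / 4) ^ n * (f_T1 \<star> f_C (nu n k \<alpha>)) s)) UNIV"
proof -
  define g where "g = \<alpha> + 1/2"
  define \<nu> where "\<nu> = nu n k \<alpha>"
  have g: "g > 0" using a by (simp add: g_def)
  have \<nu>: "\<nu> > 0" "\<nu> = g + real (2 * n + k)" using g by (simp_all add: \<nu>_def nu_def g_def)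
  define A where "A = Gamma (\<nu> + 1) * (x * y) ^ k / (fact k * fact n * Gamma (\<alpha> + real n + 1))
        * ((1 - x\<^sup>2) * (1 - y\<^sup>2) / 4) ^ n"
  have "((\<lambda>m. A * (cosh_coeff \<nu> m * (\<nu> + 2 * real m) / \<nu> * heat (2 * real m + \<nu>) s)) has_sum
      A * (f_T1 \<star> f_C \<nu>) s) UNIV"
    by (intro has_sum_cmult_right f_T1_star_f_C_has_sum \<nu> s)
  moreover have "A * (cosh_coeff \<nu> m * (\<nu> + 2 * real m) / \<nu> * heat (2 * real m + \<nu>) s) = expansion_term g s x y n k m" for m
  proof -
    define M where "M = real (2 * n + k + 2 * m) + g"
    define D where "D = fact n * Gamma (g + 1/2 + real n)"
    have M: "\<nu> + 2 * real m = M" "2 * real m + \<nu> = M" by (simp_all add: M_def \<nu>)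
    have D: "fact k * fact n * Gamma (\<alpha> + real n + 1) = fact k * D"
      by (simp add: D_def g_def add_ac)
    have "Gamma (\<nu> + 1) / \<nu> * pochhammer \<nu> m = Gamma \<nu> * pochhammer \<nu> m"
      using \<nu>(1) by (simp add: Gamma_real_plus1)
    also have "\<dots> = Gamma (\<nu> + real m)"
      using \<nu>(1) by (simp add: pochhammer_Gamma nonpos_Ints_def Gamma_eq_zero_iff)
    also have "\<nu> + real m = g + real (2 * n + k + m)" by (simp add: \<nu>)
    finally have G: "Gamma (\<nu> + 1) / \<nu> * pochhammer \<nu> m = Gamma (g + real (2 * n + k + m))" .
    have W: "2 powr \<nu> * ((1 - x\<^sup>2) * (1 - y\<^sup>2) / 4) ^ n = 2 powr g * ((1 - x\<^sup>2) * (1 - y\<^sup>2)) ^ n * 2 ^ k"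
    proof -
      have "2 powr \<nu> = 2 powr g * (4 ^ n * 2 ^ k)"
        unfolding \<nu>(2) powr_add powr_realpow[OF zero_less_numeral] by (simp add: power_add power_mult)
      then show ?thesis by (simp add: power_divide)
    qed
    have "A * (cosh_coeff \<nu> m * (\<nu> + 2 * real m) / \<nu> * heat (2 * real m + \<nu>) s)
       = (Gamma (\<nu> + 1) / \<nu> * pochhammer \<nu> m) * (2 powr \<nu> * ((1 - x\<^sup>2) * (1 - y\<^sup>2) / 4) ^ n)
         * ((x * y) ^ k * (-1) ^ m * M * heat M s / (fact k * D * fact m))"
      unfolding A_def cosh_coeff_def M D
      by (simp only: divide_inverse inverse_mult_distrib mult_ac)
    also have "\<dots> = expansion_term g s x y n k m"
      unfolding G W expansion_term_def M_def[symmetric] D_def[symmetric]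
      by (simp only: divide_inverse inverse_mult_distrib mult_ac)
    finally show ?thesis .
  qed
  ultimately show ?thesis unfolding A_def \<nu>_def g_def by simp
qed

text \<open>Summability is part of the claim because \<open>infsum\<close> takes the default value 0
  on families that are not summable.\<close>

theorem mainTheorem2:
  fixes \<alpha> \<gamma> t x y :: real
  assumes "\<alpha> > -1/2" and "\<gamma> = \<alpha> + 1/2"
    and "t > 0" and "x \<in> {-1<..<1}" and "y \<in> {-1<..<1}"
  shows "let a = (\<lambda>(n::nat, k::nat).
               Gamma (nu n k \<alpha> + 1) * (x * y) ^ k
                 / (fact k * fact n * Gamma (\<alpha> + real n + 1))
               * ((1 - x\<^sup>2) * (1 - y\<^sup>2) / 4) ^ n
               * (f_T1 \<star> f_C (nu n k \<alpha>)) (1 / (2 * t)))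
         in a summable_on UNIV \<and>
            ultra_density \<alpha> t x y =
              sqrt pi * K_const \<alpha> * (exp (\<gamma>\<^sup>2 * t) / sqrt t) * ultra_weight \<alpha> y
                * (\<Sum>\<^sub>\<infinity>nk\<in>UNIV. a nk)"
proof -
  define s where "s = 1 / (2 * t)"
  have s: "s > 0" and \<gamma>: "\<gamma> > 0" using assms by (simp_all add: s_def)
  define a where "a = (\<lambda>(n::nat, k::nat).
               Gamma (nu n k \<alpha> + 1) * (x * y) ^ k
                 / (fact k * fact n * Gamma (\<alpha> + real n + 1))
               * ((1 - x\<^sup>2) * (1 - y\<^sup>2) / 4) ^ n
               * (f_T1 \<star> f_C (nu n k \<alpha>)) s)"
  have "(\<lambda>((n, k), m). expansion_term \<gamma> s x y n k m) summable_on UNIV"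
    using assms s \<gamma> by (intro expansion_term_summable) auto
  then obtain S where S: "((\<lambda>((n, k), m). expansion_term \<gamma> s x y n k m) has_sum S) UNIV"
    by (auto simp: summable_on_def)
  have S': "((\<lambda>((n, k), m). expansion_term \<gamma> s x y n k m) has_sum S) (UNIV \<times> UNIV)"
    using S by simp
  \<comment> \<open>The triple family is summed over m first here, and along N = 2n + k + 2m in the
    spectral series; absolute summability makes the two totals equal.\<close>
  have aS: "(a has_sum S) UNIV"
  proof (rule has_sum_SigmaD[OF S'])
    fix nk :: "nat \<times> nat"
    show "((\<lambda>m. (\<lambda>((n, k), m). expansion_term \<gamma> s x y n k m) (nk, m)) has_sum a nk) UNIV"
      using expansion_term_has_sum_convolution[OF assms(1) s]
      unfolding a_def assms(2) by (cases nk) simp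
  qed
  define c where "c = sqrt pi * K_const \<alpha> * (exp (\<gamma>\<^sup>2 * t) / sqrt t)"
  have summand: "inverse (ultra_sqnorm N \<alpha>) * exp (- (real N * (real N + 2 * \<alpha> + 1) * t))
            * jacobi_P N \<alpha> \<alpha> x * jacobi_P N \<alpha> \<alpha> y
     = c * (2 powr \<gamma> * (real N + \<gamma>) * heat (real N + \<gamma>) s * ultra_product_kernel N \<gamma> x y)" for N
  proof -
    define U where "U = ultra_product_kernel N \<gamma> x y"
    have e: "exp (- (real N * (real N + 2 * \<alpha> + 1) * t)) = exp (\<gamma>\<^sup>2 * t) * exp (- ((real N + \<gamma>)\<^sup>2 * t))"
      unfolding exp_add[symmetric] assms(2) by (simp add: power2_eq_square algebra_simps)
    \<comment> \<open>At s = 1/(2t) the normalising factor 1/sqrt(2 pi s) is sqrt(t/pi), the origin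
      of sqrt(pi)/sqrt(t) in the formula.\<close>
    have h: "exp (- ((real N + \<gamma>)\<^sup>2 * t)) = sqrt pi / sqrt t * heat (real N + \<gamma>) s"
      using assms(3) by (simp add: heat_def s_def real_sqrt_divide)
    have k: "Gamma (\<alpha> + 1) / Gamma (\<alpha> + 3/2) = K_const \<alpha> * 2 powr \<gamma>"
      by (simp add: K_const_def assms(2))
    have "inverse (ultra_sqnorm N \<alpha>) * exp (- (real N * (real N + 2 * \<alpha> + 1) * t))
            * jacobi_P N \<alpha> \<alpha> x * jacobi_P N \<alpha> \<alpha> y
      = exp (- (real N * (real N + 2 * \<alpha> + 1) * t))
        * (inverse (ultra_sqnorm N \<alpha>) * jacobi_P N \<alpha> \<alpha> x * jacobi_P N \<alpha> \<alpha> y)"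
      by (simp only: mult_ac)
    also have "inverse (ultra_sqnorm N \<alpha>) * jacobi_P N \<alpha> \<alpha> x * jacobi_P N \<alpha> \<alpha> y
        = K_const \<alpha> * 2 powr \<gamma> * (real N + \<gamma>) * U"
      unfolding jacobi_product_eq_kernel[OF assms(1)] k U_def
      by (simp only: assms(2) add.assoc)
    finally show ?thesis
      unfolding e h c_def U_def by (simp only: divide_inverse mult_ac)
  qed
  have "(\<lambda>N. inverse (ultra_sqnorm N \<alpha>) * exp (- (real N * (real N + 2 * \<alpha> + 1) * t))
            * jacobi_P N \<alpha> \<alpha> x * jacobi_P N \<alpha> \<alpha> y) sums (c * S)"
    unfolding summand by (intro sums_mult expansion_term_regroup S)
  then have "ultra_density \<alpha> t x y = c * S * ultra_weight \<alpha> y"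
    unfolding ultra_density_def by (simp add: sums_iff)
  then have "ultra_density \<alpha> t x y = c * ultra_weight \<alpha> y * infsum a UNIV"
    using infsumI[OF aS] by simp
  then show ?thesis
    using has_sum_imp_summable[OF aS] unfolding a_def s_def c_def Let_def by blast
qed

end
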